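(* Let $D$ be a division algebra of degree $p$ over its center $F=Z(D)$, let $N=p^2=[D:F]$, and let $a_1,\dots,a_{N-1}\in D$ be invertible elements such that $D=F+Fa_1+\dots+Fa_{N-1}$. Let $k\in\mathbb{N}$ and $A\in M_k(D)$, and let $p_A(z)=h^{-1}\big(\det(\widehat{A-\lambda I})\big)\in D_G[z]$ be the characteristic polynomial of $A$, as defined in the context. Then the left eigenvalues of $A$ are precisely the roots of $p_A(z)$. The degree of the characteristic polynomial $p_A(z)$ is $kp$.
   Context: A left eigenvalue of $A\in M_k(D)$ is an element $\lambda\in D$ for which there exists a nonzero column vector $v\in D^{k\times 1}$ with $Av=\lambda v$. $D_G[z]$ (the ring of general polynomials over $D$) is the associative ring of polynomials over $D$ in one variable $z$, where $z$ is assumed to commute with every element of $F=Z(D)$ but not with arbitrary elements of $D$. For every $\lambda\in D$ the substitution map $D_G[z]\to D$, $z\mapsto\lambda$, is a ring homomorphism; a root of a general polynomial is an element of $D$ at which the substitution gives $0$. The ring $D_G[z]$ is graded, the degree-$n$ component being spanned by the monomials $b_1zb_2\cdots b_nzb_{n+1}$ with $b_i\in D$. $D\langle x_1,\dots,x_N\rangle$ is the ring of polynomials over $D$ in $x_1,\dots,x_N$ where each $x_i$ commutes with every element of $D$ and is not assumed to commute with $x_j$ for $j\neq i$ (the monoid algebra over $D$ of the free monoid on $x_1,\dots,x_N$). The ring homomorphism $h: D_G[z]\to D\langle x_1,\dots,x_N\rangle$ with $h(d)=d$ for all $d\in D$ and $h(z)=x_1+a_1x_2+\dots+a_{N-1}x_N$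 is an isomorphism. Let $K$ be a maximal subfield of $D$ (in particular $[K:F]=p$). There is an injection of $D$ in $M_p(K)$, and more generally there is an injection of $M_k(D)$ in $M_{kp}(K)$ for any $k\in\mathbb{N}$; for $B\in M_k(D)$, $\widehat{B}$ denotes the image of $B$ in $M_{kp}(K)$. The determinant of $\widehat{B}$ (the reduced norm of $B$) is equal to the Dieudonné determinant of $B$ to the power of $p$, so $\lambda\in D$ is a left eigenvalue of $A$ if and only if $\det(\widehat{A-\lambda I})=0$. Considering $D$ as an $F$-vector space, write $\lambda=x_1+x_2a_1+\dots+x_Na_{N-1}$ with $x_1,\dots,x_N\in F$. Then $\det(\widehat{A-\lambda I})\in F[x_1,\dots,x_N]$, a polynomial in the coordinates $x_1,\dots,x_N$ of $\lambda$; it can also be considered as a polynomial in $D\langle x_1,\dots,x_N\rangle$. The characteristic polynomial of $A$ is defined to be $p_A(z)=h^{-1}\big(\det(\widehat{A-\lambda I})\big)\in D_G[z]$. *)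

theory Defs
  imports
    "HOL-Library.Poly_Mapping"
    "HOL-Library.Multiset"
    "Jordan_Normal_Form.Determinant"
begin

no_notation Group.m_inv (\<open>(\<open>open_block notation=\<open>prefix inv\<close>\<close>inv\<index> _)\<close> [81] 80)

section \<open>The center of a division ring as a field\<close>

typedef (overloaded) 'd center = "{c :: 'd::division_ring. \<forall>x. c * x = x * c}"
  morphisms of_center to_center
  by (rule exI[of _ 0]) simp

setup_lifting type_definition_center

lemma of_center_commute: "of_center c * x = x * of_center c"
  using of_center[of c] by simp

lemma center_inverse:
  fixes c :: "'d::division_ring"
  assumes "\<And>x. c * x = x * c"
  shows "inverse c * x = x * inverse c"
proof (cases "c = 0")
  case False
  have "inverse c * x = inverse c * (x * c) * inverse c"
    using False by (simp add: mult.assoc)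
  also have "\<dots> = inverse c * (c * x) * inverse c"
    by (simp add: assms)
  also have "\<dots> = x * inverse c"
    using False by (simp flip: mult.assoc)
  finally show ?thesis .
qed simp

instantiation center :: (division_ring) field
begin

lift_definition zero_center :: "'a center" is 0 by simp
lift_definition one_center :: "'a center" is 1 by simp
lift_definition plus_center :: "'a center \<Rightarrow> 'a center \<Rightarrow> 'a center" is "(+)"
  by (simp add: algebra_simps)
lift_definition uminus_center :: "'a center \<Rightarrow> 'a center" is uminus
  by simp
lift_definition minus_center :: "'a center \<Rightarrow> 'a center \<Rightarrow> 'a center" is "(-)"
  by (simp add: algebra_simps)
lift_definition times_center :: "'a center \<Rightarrow> 'a center \<Rightarrow> 'a center" is "(*)"
  by (metis mult.assoc)
lift_definition inverse_center :: "'a center \<Rightarrow> 'a center" is inverse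
  using center_inverse by blast
lift_definition divide_center :: "'a center \<Rightarrow> 'a center \<Rightarrow> 'a center" is "(div)"
  unfolding divide_inverse by (metis center_inverse mult.assoc)

instance
proof
  fix a b c :: "'a center"
  note inject = of_center_inject[symmetric] zero_center.rep_eq one_center.rep_eq
    plus_center.rep_eq uminus_center.rep_eq minus_center.rep_eq times_center.rep_eq
    inverse_center.rep_eq divide_center.rep_eq
  show "a + b + c = a + (b + c)" by (simp only: inject add.assoc)
  show "a + b = b + a" by (simp only: inject add.commute)
  show "0 + a = a" by (simp only: inject add_0_left)
  show "- a + a = 0" by (simp only: inject left_minus)
  show "a - b = a + - b" by (simp only: inject diff_conv_add_uminus)
  show "a * b * c = a * (b * c)" by (simp only: inject mult.assoc)
  show "a * b = b * a" unfolding inject by (rule of_center_commute)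
  show "1 * a = a" by (simp only: inject mult_1_left)
  show "(a + b) * c = a * c + b * c" by (simp only: inject distrib_right)
  show "(0 :: 'a center) \<noteq> 1" unfolding inject by (rule zero_neq_one)
  show "inverse a * a = 1" if "a \<noteq> 0"
    using that unfolding inject by (rule left_inverse)
  show "a div b = a * inverse b" unfolding inject by (rule divide_inverse)
  show "inverse (0 :: 'a center) = 0" unfolding inject by (rule inverse_zero)
qed

end

definition center_scale :: "'d::division_ring center \<Rightarrow> 'd \<Rightarrow> 'd" where
  "center_scale c x = of_center c * x"

lemma vector_space_center_scale: "vector_space center_scale"
  by unfold_locales
    (simp_all add: center_scale_def algebra_simps plus_center.rep_eq times_center.rep_eq
      one_center.rep_eq)

definition subfield_of :: "'d::division_ring set \<Rightarrow> bool" where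
  "subfield_of S \<longleftrightarrow> 1 \<in> S
     \<and> (\<forall>x\<in>S. \<forall>y\<in>S. x - y \<in> S \<and> x * y \<in> S \<and> x * y = y * x)
     \<and> (\<forall>x\<in>S. inverse x \<in> S)"

definition maximal_subfield :: "'d::division_ring set \<Rightarrow> bool" where
  "maximal_subfield S \<longleftrightarrow> subfield_of S \<and> (\<forall>T. subfield_of T \<and> S \<subseteq> T \<longrightarrow> T = S)"

definition left_eigenvalue :: "'d::division_ring mat \<Rightarrow> 'd \<Rightarrow> bool" where
  "left_eigenvalue A l \<longleftrightarrow>
     (\<exists>v \<in> carrier_vec (dim_col A). v \<noteq> 0\<^sub>v (dim_col A) \<and> A *\<^sub>v v = l \<cdot>\<^sub>v v)"


section \<open>Free monoids\<close>

datatype 'a free_monoid = Word (letters: "'a list")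

instantiation free_monoid :: (type) monoid_add
begin

definition zero_free_monoid :: "'a free_monoid" where "0 = Word []"
definition plus_free_monoid :: "'a free_monoid \<Rightarrow> 'a free_monoid \<Rightarrow> 'a free_monoid" where
  "u + v = Word (letters u @ letters v)"

instance
  by standard (simp_all add: zero_free_monoid_def plus_free_monoid_def)

end


section \<open>The ring of general polynomials\<close>

text \<open>The ring of general polynomials is presented by generators and relations: take the free ring
  (the monoid ring over the integers of a free monoid) on symbols \<open>Some d\<close>, one for every element
  \<open>d\<close> of the division ring, and \<open>None\<close> for the variable \<open>z\<close>, and impose the ring operations of the
  division ring and that \<open>z\<close> commutes with the center.\<close>

type_synonym 'd pre_gpoly = "'d option free_monoid \<Rightarrow>\<^sub>0 int"

definition pre_const :: "'d \<Rightarrow> 'd pre_gpoly" where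
  "pre_const d = Poly_Mapping.single (Word [Some d]) 1"

definition pre_z :: "'d pre_gpoly" where
  "pre_z = Poly_Mapping.single (Word [None]) 1"

definition gp_relations :: "'d::division_ring pre_gpoly set" where
  "gp_relations =
     {pre_const (d + e) - (pre_const d + pre_const e) | d e. True}
     \<union> {pre_const (d * e) - pre_const d * pre_const e | d e. True}
     \<union> {pre_const 1 - 1}
     \<union> {pre_const (of_center c) * pre_z - pre_z * pre_const (of_center c) | c. True}"

inductive_set gp_ideal :: "'d::division_ring pre_gpoly set" where
  zero: "0 \<in> gp_ideal"
| add: "f \<in> gp_ideal \<Longrightarrow> g \<in> gp_ideal \<Longrightarrow> f + g \<in> gp_ideal"
| rel: "r \<in> gp_relations \<Longrightarrow> u * r * v \<in> gp_ideal"

lemma gp_ideal_mult: "f \<in> gp_ideal \<Longrightarrow> u * f * v \<in> gp_ideal"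
proof (induction rule: gp_ideal.induct)
  case zero
  show ?case by (simp add: gp_ideal.zero)
next
  case (add f g)
  then show ?case by (simp add: algebra_simps gp_ideal.add)
next
  case (rel r u' v')
  have "u * (u' * r * v') * v = (u * u') * r * (v' * v)" by (simp add: mult.assoc)
  with rel show ?case by (metis gp_ideal.rel)
qed

lemma gp_ideal_mult_left: "f \<in> gp_ideal \<Longrightarrow> u * f \<in> gp_ideal"
  using gp_ideal_mult[of f u 1] by simp

lemma gp_ideal_mult_right: "f \<in> gp_ideal \<Longrightarrow> f * v \<in> gp_ideal"
  using gp_ideal_mult[of f 1 v] by simp

lemma gp_ideal_uminus: "f \<in> gp_ideal \<Longrightarrow> - f \<in> gp_ideal"
  using gp_ideal_mult[of f "- 1" 1] by simp

lemma gp_relations_ideal: "r \<in> gp_relations \<Longrightarrow> r \<in> gp_ideal"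
  using gp_ideal.rel[of r 1 1] by simp

subsection \<open>Evaluation of the free ring\<close>

definition word_eval :: "('d \<Rightarrow> 'r::ring_1) \<Rightarrow> 'r \<Rightarrow> 'd option free_monoid \<Rightarrow> 'r" where
  "word_eval \<phi> t w = prod_list (map (case_option t \<phi>) (letters w))"

definition pre_eval :: "('d \<Rightarrow> 'r::ring_1) \<Rightarrow> 'r \<Rightarrow> 'd pre_gpoly \<Rightarrow> 'r" where
  "pre_eval \<phi> t f = (\<Sum>w\<in>Poly_Mapping.keys f. of_int (Poly_Mapping.lookup f w) * word_eval \<phi> t w)"

lemma word_eval_zero: "word_eval \<phi> t 0 = 1"
  by (simp add: word_eval_def zero_free_monoid_def)

lemma word_eval_plus: "word_eval \<phi> t (u + v) = word_eval \<phi> t u * word_eval \<phi> t v"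
  by (simp add: word_eval_def plus_free_monoid_def)

lemma pre_eval_single: "pre_eval \<phi> t (Poly_Mapping.single w c) = of_int c * word_eval \<phi> t w"
  by (simp add: pre_eval_def)

lemma pre_eval_zero: "pre_eval \<phi> t 0 = 0"
  by (simp add: pre_eval_def)

lemma pre_eval_add: "pre_eval \<phi> t (f + g) = pre_eval \<phi> t f + pre_eval \<phi> t g"
  unfolding pre_eval_def by (rule setsum_keys_plus_distrib) (simp_all add: algebra_simps)

lemma pre_eval_minus: "pre_eval \<phi> t (f - g) = pre_eval \<phi> t f - pre_eval \<phi> t g"
  using pre_eval_add[of \<phi> t "f - g" g] by (simp add: algebra_simps)

lemma pre_eval_one: "pre_eval \<phi> t 1 = 1"
  using pre_eval_single[of \<phi> t 0 1] by (simp add: word_eval_zero)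

lemma pre_eval_mult_single:
  "pre_eval \<phi> t (Poly_Mapping.single u 1 * g) = word_eval \<phi> t u * pre_eval \<phi> t g"
proof (rule frag_induction[of g UNIV])
  show "pre_eval \<phi> t (Poly_Mapping.single u 1 * frag_of w) = word_eval \<phi> t u * pre_eval \<phi> t (frag_of w)"
    for w by (simp add: mult_single pre_eval_single word_eval_plus)
qed (simp_all add: pre_eval_zero pre_eval_minus algebra_simps)

lemma pre_eval_mult: "pre_eval \<phi> t (f * g) = pre_eval \<phi> t f * pre_eval \<phi> t g"
proof (rule frag_induction[of f UNIV])
  show "pre_eval \<phi> t (frag_of w * g) = pre_eval \<phi> t (frag_of w) * pre_eval \<phi> t g" for w
    unfolding pre_eval_mult_single by (simp add: pre_eval_single)
qed (simp_all add: pre_eval_zero pre_eval_minus algebra_simps)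

lemma pre_eval_const: "pre_eval \<phi> t (pre_const d) = \<phi> d"
  by (simp add: pre_const_def pre_eval_single word_eval_def)

lemma pre_eval_z: "pre_eval \<phi> t pre_z = t"
  by (simp add: pre_z_def pre_eval_single word_eval_def)

lemma pre_eval_ideal:
  fixes \<phi> :: "'d::division_ring \<Rightarrow> 'r::ring_1"
  assumes hom: "Ring_Hom.ring_hom \<phi>"
    and comm: "\<And>c. \<phi> (of_center c) * t = t * \<phi> (of_center c)"
    and "f \<in> gp_ideal"
  shows "pre_eval \<phi> t f = 0"
proof -
  interpret Ring_Hom.ring_hom \<phi> by (rule hom)
  from assms(3) show ?thesis
  proof (induction rule: gp_ideal.induct)
    case (rel r u v)
    then have "pre_eval \<phi> t r = 0"
      by (auto simp: gp_relations_def pre_eval_minus pre_eval_add pre_eval_mult pre_eval_const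
          pre_eval_z pre_eval_one hom_distribs comm)
    then show ?case by (simp add: pre_eval_mult)
  qed (simp_all add: pre_eval_zero pre_eval_add)
qed

lemma one_notin_gp_ideal: "1 \<notin> (gp_ideal :: 'd::division_ring pre_gpoly set)"
proof
  assume "1 \<in> (gp_ideal :: 'd pre_gpoly set)"
  then have "pre_eval (\<lambda>x :: 'd. x) 0 1 = (0 :: 'd)"
    by (rule pre_eval_ideal[rotated 2]) (unfold_locales, simp_all)
  then show False by (simp add: pre_eval_one)
qed


subsection \<open>The quotient ring\<close>

definition gp_rel :: "'d::division_ring pre_gpoly \<Rightarrow> 'd pre_gpoly \<Rightarrow> bool" where
  "gp_rel f g \<longleftrightarrow> f - g \<in> gp_ideal"

lemma equivp_gp_rel: "equivp gp_rel"
proof (rule equivpI)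
  show "reflp gp_rel" by (rule reflpI) (simp add: gp_rel_def gp_ideal.zero)
  show "symp gp_rel"
    by (rule sympI) (metis gp_rel_def gp_ideal_uminus minus_diff_eq)
  show "transp gp_rel"
  proof (rule transpI)
    fix f g h :: "'d::division_ring pre_gpoly"
    assume "gp_rel f g" "gp_rel g h"
    then have "(f - g) + (g - h) \<in> gp_ideal" unfolding gp_rel_def by (rule gp_ideal.add)
    then show "gp_rel f h" by (simp add: gp_rel_def)
  qed
qed

quotient_type (overloaded) 'd gpoly = "'d::division_ring pre_gpoly" / gp_rel
  by (rule equivp_gp_rel)

instantiation gpoly :: (division_ring) ring_1
begin

lift_definition zero_gpoly :: "'a gpoly" is 0 .
lift_definition one_gpoly :: "'a gpoly" is 1 .
lift_definition plus_gpoly :: "'a gpoly \<Rightarrow> 'a gpoly \<Rightarrow> 'a gpoly" is "(+)"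
proof -
  fix f g f' g' :: "'a pre_gpoly"
  assume "gp_rel f g" "gp_rel f' g'"
  then have "(f - g) + (f' - g') \<in> gp_ideal" unfolding gp_rel_def by (rule gp_ideal.add)
  then show "gp_rel (f + f') (g + g')" by (simp add: gp_rel_def algebra_simps)
qed
lift_definition uminus_gpoly :: "'a gpoly \<Rightarrow> 'a gpoly" is uminus
proof -
  fix f g :: "'a pre_gpoly"
  assume "gp_rel f g"
  then have "- (f - g) \<in> gp_ideal" unfolding gp_rel_def by (rule gp_ideal_uminus)
  then show "gp_rel (- f) (- g)" by (simp add: gp_rel_def)
qed
lift_definition minus_gpoly :: "'a gpoly \<Rightarrow> 'a gpoly \<Rightarrow> 'a gpoly" is "(-)"
proof -
  fix f g f' g' :: "'a pre_gpoly"
  assume "gp_rel f g" "gp_rel f' g'"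
  then have "(f - g) + - (f' - g') \<in> gp_ideal"
    unfolding gp_rel_def by (intro gp_ideal.add gp_ideal_uminus)
  then show "gp_rel (f - f') (g - g')" by (simp add: gp_rel_def algebra_simps)
qed
lift_definition times_gpoly :: "'a gpoly \<Rightarrow> 'a gpoly \<Rightarrow> 'a gpoly" is "(*)"
proof -
  fix f g f' g' :: "'a pre_gpoly"
  assume "gp_rel f g" "gp_rel f' g'"
  then have "(f - g) * f' + g * (f' - g') \<in> gp_ideal"
    unfolding gp_rel_def by (intro gp_ideal.add gp_ideal_mult_left gp_ideal_mult_right)
  then show "gp_rel (f * f') (g * g')" by (simp add: gp_rel_def algebra_simps)
qed

instance
proof
  show "(0 :: 'a gpoly) \<noteq> 1"
  proof (transfer, rule notI)
    assume "gp_rel (0 :: 'a pre_gpoly) 1"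
    then have "- (0 - 1) \<in> (gp_ideal :: 'a pre_gpoly set)"
      unfolding gp_rel_def by (rule gp_ideal_uminus)
    then show False by (simp add: one_notin_gp_ideal)
  qed
qed (transfer; simp add: gp_rel_def gp_ideal.zero algebra_simps)+

end

lift_definition gp_const :: "'d::division_ring \<Rightarrow> 'd gpoly" is pre_const .

lift_definition gp_z :: "'d::division_ring gpoly" is pre_z .

text \<open>The homomorphism out of the ring of general polynomials determined by a ring homomorphism on
  the constants and a value for \<open>z\<close>.\<close>

lift_definition gp_lift :: "('d::division_ring \<Rightarrow> 'r::ring_1) \<Rightarrow> 'r \<Rightarrow> 'd gpoly \<Rightarrow> 'r" is
  "\<lambda>\<phi> t f. if Ring_Hom.ring_hom \<phi> \<and> (\<forall>c. \<phi> (of_center c) * t = t * \<phi> (of_center c))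
            then pre_eval \<phi> t f else 0"
proof -
  fix \<phi> :: "'d \<Rightarrow> 'r" and t :: 'r and f g :: "'d pre_gpoly"
  assume "gp_rel f g"
  then show "(if Ring_Hom.ring_hom \<phi> \<and> (\<forall>c. \<phi> (of_center c) * t = t * \<phi> (of_center c))
      then pre_eval \<phi> t f else 0) =
    (if Ring_Hom.ring_hom \<phi> \<and> (\<forall>c. \<phi> (of_center c) * t = t * \<phi> (of_center c))
      then pre_eval \<phi> t g else 0)"
    using pre_eval_ideal[of \<phi> t "f - g"] by (auto simp: gp_rel_def pre_eval_minus)
qed

lemma gp_lift:
  fixes \<phi> :: "'d::division_ring \<Rightarrow> 'r::ring_1"
  assumes "Ring_Hom.ring_hom \<phi>" and "\<And>c. \<phi> (of_center c) * t = t * \<phi> (of_center c)"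
  shows "Ring_Hom.ring_hom (gp_lift \<phi> t)"
    and "gp_lift \<phi> t (gp_const d) = \<phi> d"
    and "gp_lift \<phi> t gp_z = t"
proof -
  have lift: "gp_lift \<phi> t (abs_gpoly f) = pre_eval \<phi> t f" for f
    unfolding gp_lift.abs_eq using assms by simp
  have ex: "\<exists>f. x = abs_gpoly f" for x :: "'d gpoly"
    by (rule exI[of _ "rep_gpoly x"]) (simp add: Quotient_abs_rep[OF Quotient_gpoly])
  show "Ring_Hom.ring_hom (gp_lift \<phi> t)"
  proof unfold_locales
    fix x y :: "'d gpoly"
    obtain f g where xy: "x = abs_gpoly f" "y = abs_gpoly g" using ex by meson
    show "gp_lift \<phi> t (x + y) = gp_lift \<phi> t x + gp_lift \<phi> t y"
      unfolding xy plus_gpoly.abs_eq lift by (rule pre_eval_add)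
    show "gp_lift \<phi> t (x * y) = gp_lift \<phi> t x * gp_lift \<phi> t y"
      unfolding xy times_gpoly.abs_eq lift by (rule pre_eval_mult)
  next
    show "gp_lift \<phi> t 0 = 0" unfolding zero_gpoly_def lift by (rule pre_eval_zero)
    show "gp_lift \<phi> t 1 = 1" unfolding one_gpoly_def lift by (rule pre_eval_one)
  qed
  show "gp_lift \<phi> t (gp_const d) = \<phi> d"
    unfolding gp_const.abs_eq lift by (rule pre_eval_const)
  show "gp_lift \<phi> t gp_z = t"
    unfolding gp_z_def lift by (rule pre_eval_z)
qed

lemma ring_hom_ident: "Ring_Hom.ring_hom (\<lambda>x :: 'a::ring_1. x)"
  by unfold_locales simp_all

definition gp_subst :: "'d::division_ring \<Rightarrow> 'd gpoly \<Rightarrow> 'd" where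
  "gp_subst l = gp_lift (\<lambda>d. d) l"

lemma gp_subst:
  "Ring_Hom.ring_hom (gp_subst l)" "gp_subst l (gp_const d) = d" "gp_subst l gp_z = l"
proof -
  have "of_center c * l = l * of_center c" for c
    using of_center[of c] by simp
  from gp_lift[OF ring_hom_ident this]
  show "Ring_Hom.ring_hom (gp_subst l)" "gp_subst l (gp_const d) = d" "gp_subst l gp_z = l"
    unfolding gp_subst_def by blast+
qed

inductive_set gp_component :: "nat \<Rightarrow> 'd::division_ring gpoly set" for n where
  zero: "0 \<in> gp_component n"
| add_monomial: "P \<in> gp_component n \<Longrightarrow> length bs = n \<Longrightarrow>
    gp_const b * prod_list (map (\<lambda>b'. gp_z * gp_const b') bs) + P \<in> gp_component n"

text \<open>The degree for the grading by \<open>gp_component\<close>, with the convention that \<open>0\<close> has degree \<open>0\<close>.\<close>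

definition gp_degree :: "'d::division_ring gpoly \<Rightarrow> nat" where
  "gp_degree P = (LEAST n. \<exists>Q. (\<forall>i\<le>n. Q i \<in> gp_component i) \<and> P = (\<Sum>i\<le>n. Q i))"


section \<open>Polynomials in central variables\<close>

text \<open>Monoid rings of free monoids have noncommuting variables that commute with all coefficients;
  monoid rings of free commutative monoids (finite multisets) are the commutative polynomial rings.
  Variables carry arbitrary natural indices; only \<open>1, \<dots>, N\<close> are used.\<close>

type_synonym 'd ncpoly = "nat free_monoid \<Rightarrow>\<^sub>0 'd"
type_synonym 'k mvpoly = "nat multiset \<Rightarrow>\<^sub>0 'k"

definition nc_const :: "'d::division_ring \<Rightarrow> 'd ncpoly" where
  "nc_const d = Poly_Mapping.single 0 d"

definition nc_var :: "nat \<Rightarrow> 'd::division_ring ncpoly" where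
  "nc_var i = Poly_Mapping.single (Word [i]) 1"

definition mv_const :: "'k::field \<Rightarrow> 'k mvpoly" where
  "mv_const c = Poly_Mapping.single 0 c"

definition mv_var :: "nat \<Rightarrow> 'k::field mvpoly" where
  "mv_var i = Poly_Mapping.single {#i#} 1"

text \<open>A commutative polynomial is read as a noncommutative one by writing every commutative
  monomial \<open>m\<close> as a word \<open>\<omega> m\<close>, that is, by fixing an order of its factors.\<close>

definition monomial_words :: "(nat multiset \<Rightarrow> nat free_monoid) \<Rightarrow> bool" where
  "monomial_words \<omega> \<longleftrightarrow> (\<forall>m. mset (letters (\<omega> m)) = m)"

definition nc_of_mv ::
  "('k::field \<Rightarrow> 'd::division_ring) \<Rightarrow> (nat multiset \<Rightarrow> nat free_monoid) \<Rightarrow> 'k mvpoly \<Rightarrow> 'd ncpoly"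
  where "nc_of_mv \<kappa> \<omega> f = (\<Sum>m\<in>Poly_Mapping.keys f. Poly_Mapping.single (\<omega> m) (\<kappa> (Poly_Mapping.lookup f m)))"

definition gp_h :: "nat \<Rightarrow> (nat \<Rightarrow> 'd::division_ring) \<Rightarrow> 'd gpoly \<Rightarrow> 'd ncpoly" where
  "gp_h N a = gp_lift nc_const (nc_var 1 + (\<Sum>i = 1..<N. nc_const (a i) * nc_var (i + 1)))"

lemma gp_h:
  "Ring_Hom.ring_hom (gp_h N a)" "gp_h N a (gp_const d) = nc_const d"
  "gp_h N a gp_z = nc_var 1 + (\<Sum>i = 1..<N. nc_const (a i) * nc_var (i + 1))"
proof -
  let ?t = "nc_var 1 + (\<Sum>i = 1..<N. nc_const (a i) * nc_var (i + 1)) :: 'a ncpoly"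
  have hom: "Ring_Hom.ring_hom (nc_const :: 'a \<Rightarrow> 'a ncpoly)"
    by unfold_locales (simp_all add: nc_const_def single_add mult_single)
  have var: "nc_const d * nc_var i = nc_var i * nc_const d" for d :: 'a and i
    by (simp add: nc_const_def nc_var_def mult_single)
  have "nc_const (of_center c) * ?t = ?t * nc_const (of_center c)" for c :: "'a center"
  proof -
    have c: "of_center c * x = x * of_center c" for x using of_center[of c] by simp
    have "nc_const (of_center c) * (nc_const (a i) * nc_var (i + 1))
      = nc_const (a i) * nc_var (i + 1) * nc_const (of_center c)" for i
    proof -
      have "nc_const (of_center c) * nc_const (a i) = nc_const (a i) * nc_const (of_center c)"
        by (simp add: nc_const_def mult_single c)
      then show ?thesis by (metis var mult.assoc)
    qed
    then show ?thesis
      by (simp add: distrib_left distrib_right sum_distrib_left sum_distrib_right var)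
  qed
  from gp_lift[OF hom this]
  show "Ring_Hom.ring_hom (gp_h N a)" "gp_h N a (gp_const d) = nc_const d" "gp_h N a gp_z = ?t"
    unfolding gp_h_def by blast+
qed


section \<open>The characteristic polynomial\<close>

text \<open>\<open>\<kappa>\<close> embeds the field \<open>'k\<close> into the division ring. A matrix embedding is an injective unital
  homomorphism of algebras over the center.\<close>

definition matrix_embedding ::
  "('k::field \<Rightarrow> 'd::division_ring) \<Rightarrow> nat \<Rightarrow> nat \<Rightarrow> ('d mat \<Rightarrow> 'k mat) \<Rightarrow> bool" where
  "matrix_embedding \<kappa> k n \<Phi> \<longleftrightarrow>
     \<Phi> \<in> carrier_mat k k \<rightarrow> carrier_mat n n
     \<and> inj_on \<Phi> (carrier_mat k k)
     \<and> (\<forall>B\<in>carrier_mat k k. \<forall>C\<in>carrier_mat k k. \<Phi> (B + C) = \<Phi> B + \<Phi> C \<and> \<Phi> (B * C) = \<Phi> B * \<Phi> C)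
     \<and> \<Phi> (1\<^sub>m k) = 1\<^sub>m n
     \<and> (\<forall>s c. \<kappa> s = of_center c \<longrightarrow> (\<forall>B\<in>carrier_mat k k. \<Phi> (\<kappa> s \<cdot>\<^sub>m B) = s \<cdot>\<^sub>m \<Phi> B))"

text \<open>The image of \<open>A - \<lambda> I\<close> for the generic \<open>\<lambda> = x\<^sub>1 + x\<^sub>2 a\<^sub>1 + \<dots> + x\<^sub>N a\<^sub>N\<^sub>-\<^sub>1\<close>.\<close>

definition generic_mat ::
  "nat \<Rightarrow> (nat \<Rightarrow> 'd::division_ring) \<Rightarrow> nat \<Rightarrow> nat \<Rightarrow> ('d mat \<Rightarrow> 'k::field mat) \<Rightarrow> 'd mat \<Rightarrow> 'k mvpoly mat"
  where
  "generic_mat N a k n \<Phi> A = mat n n (\<lambda>rs. mv_const (\<Phi> A $$ rs)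
     - (mv_var 1 * mv_const (\<Phi> (1\<^sub>m k) $$ rs)
        + (\<Sum>i = 1..<N. mv_var (i + 1) * mv_const (\<Phi> (a i \<cdot>\<^sub>m 1\<^sub>m k) $$ rs))))"

definition gp_char_poly ::
  "('k::field \<Rightarrow> 'd::division_ring) \<Rightarrow> (nat multiset \<Rightarrow> nat free_monoid) \<Rightarrow> nat \<Rightarrow> (nat \<Rightarrow> 'd) \<Rightarrow>
    nat \<Rightarrow> nat \<Rightarrow> ('d mat \<Rightarrow> 'k mat) \<Rightarrow> 'd mat \<Rightarrow> 'd gpoly" where
  "gp_char_poly \<kappa> \<omega> N a k n \<Phi> A =
     inv (gp_h N a) (nc_of_mv \<kappa> \<omega> (det (generic_mat N a k n \<Phi> A)))"

end

theory Submission
  imports Defs "Jordan_Normal_Form.Char_Poly"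
begin

text \<open>By density, for every center basis \<open>e\<close> of \<open>D\<close> the coordinate functions are multiplication
  operators \<open>x \<mapsto> \<Sum> u x v\<close>, and a multiplication operator determines \<open>\<Sum> u \<otimes> v\<close>. Hence the elements
  \<open>\<Sum> u z v\<close> of the ring of general polynomials commute with \<open>D\<close> and recover the central variables, so
  that \<open>h\<close> is bijective onto the polynomials in \<open>x\<^sub>1, \<dots>, x\<^sub>N\<close>, with a degree preserving inverse.
  Substituting \<open>\<lambda>\<close> for \<open>z\<close> becomes substituting the coordinates of \<open>\<lambda>\<close> for the variables, which turns
  the generic determinant into the determinant of the image of \<open>A - \<lambda> I\<close>. It vanishes iff \<open>A - \<lambda> I\<close> has
  a kernel, as a matrix over \<open>D\<close> without kernel has a right inverse.\<close>

section \<open>Multiplication operators\<close>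

text \<open>A list of pairs stands for the tensor \<open>\<Sum> u \<otimes> v\<close>. With
  \<open>\<phi>\<close> the identity it acts on the division ring as a multiplication operator; with
  \<open>gp_const\<close> and \<open>gp_z\<close> it is a homogeneous general polynomial of degree
  one. The same list can thus be read in both rings.\<close>

definition two_sided :: "('d::ring_1 \<Rightarrow> 'r::ring_1) \<Rightarrow> 'r \<Rightarrow> ('d \<times> 'd) list \<Rightarrow> 'r" where
  "two_sided \<phi> t ps = (\<Sum>(u, v)\<leftarrow>ps. \<phi> u * t * \<phi> v)"

lemma two_sided_simps [simp]:
  "two_sided \<phi> t [] = 0"
  "two_sided \<phi> t ((u, v) # ps) = \<phi> u * t * \<phi> v + two_sided \<phi> t ps"
  "two_sided \<phi> t (ps @ qs) = two_sided \<phi> t ps + two_sided \<phi> t qs"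
  by (simp_all add: two_sided_def)

abbreviation two_sided_op :: "('d::ring_1 \<times> 'd) list \<Rightarrow> 'd \<Rightarrow> 'd" where
  "two_sided_op ps x \<equiv> two_sided (\<lambda>d. d) x ps"

lemma two_sided_scale_left:
  assumes "Ring_Hom.ring_hom \<phi>"
  shows "two_sided \<phi> t (map (map_prod ((*) c) id) ps) = \<phi> c * two_sided \<phi> t ps"
proof -
  interpret Ring_Hom.ring_hom \<phi> by fact
  show ?thesis by (induction ps) (auto simp: hom_distribs distrib_left mult.assoc)
qed

lemma two_sided_scale_right:
  assumes "Ring_Hom.ring_hom \<phi>"
  shows "two_sided \<phi> t (map (map_prod id (\<lambda>x. x * c)) ps) = two_sided \<phi> t ps * \<phi> c"
proof -
  interpret Ring_Hom.ring_hom \<phi> by fact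
  show ?thesis by (induction ps) (auto simp: hom_distribs distrib_right mult.assoc)
qed

lemma two_sided_op_add: "two_sided_op ps (x + y) = two_sided_op ps x + two_sided_op ps y"
  by (induction ps) (auto simp: algebra_simps)

lemma two_sided_op_sum: "two_sided_op ps (\<Sum>i\<in>I. f i) = (\<Sum>i\<in>I. two_sided_op ps (f i))"
proof (induction I rule: infinite_finite_induct)
  have "two_sided_op ps 0 = 0" by (induction ps) auto
  then show "two_sided_op ps (\<Sum>i\<in>A. f i) = (\<Sum>i\<in>A. two_sided_op ps (f i))" if "infinite A" for A
    using that by simp
  show "two_sided_op ps (\<Sum>i\<in>{}. f i) = (\<Sum>i\<in>{}. two_sided_op ps (f i))"
    using \<open>two_sided_op ps 0 = 0\<close> by simp
qed (simp add: two_sided_op_add)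

lemma two_sided_op_center:
  "two_sided_op ps (of_center c * x) = of_center c * two_sided_op ps x"
proof (induction ps)
  case (Cons p ps)
  have "fst p * (of_center c * x) * snd p = of_center c * (fst p * x * snd p)"
    by (metis mult.assoc of_center_commute)
  with Cons show ?case by (cases p) (simp add: distrib_left)
qed simp

text \<open>A single list \<open>qs\<close> realizes the combination both as an operator and in the
  target of \<open>\<phi>\<close>, so that an operator identity can be carried over to general
  polynomials.\<close>

lemma two_sided_linear_combination:
  fixes R :: "'i \<Rightarrow> ('d::ring_1 \<times> 'd) list"
  assumes "Ring_Hom.ring_hom (\<phi> :: 'd \<Rightarrow> 'r::ring_1)"
  obtains qs where "\<And>x. two_sided_op qs x = (\<Sum>i\<in>I. w i * two_sided_op (R i) x)"
    and "\<And>t. two_sided \<phi> t qs = (\<Sum>i\<in>I. \<phi> (w i) * two_sided \<phi> t (R i))"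
proof -
  have "\<exists>qs. (\<forall>x. two_sided_op qs x = (\<Sum>i\<in>I. w i * two_sided_op (R i) x)) \<and>
    (\<forall>t. two_sided \<phi> t qs = (\<Sum>i\<in>I. \<phi> (w i) * two_sided \<phi> t (R i)))"
  proof (induction I rule: infinite_finite_induct)
    case (insert i I)
    then obtain qs where qs: "\<And>x. two_sided_op qs x = (\<Sum>i\<in>I. w i * two_sided_op (R i) x)"
      "\<And>t. two_sided \<phi> t qs = (\<Sum>i\<in>I. \<phi> (w i) * two_sided \<phi> t (R i))" by blast
    show ?case
      by (rule exI[of _ "map (map_prod ((*) (w i)) id) (R i) @ qs"])
        (use insert in \<open>simp add: qs two_sided_scale_left[OF assms] two_sided_scale_left[OF ring_hom_ident]\<close>)
  qed (auto intro: exI[of _ "[]"])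
  then show ?thesis using that by blast
qed

section \<open>Independence over the center and dual operators\<close>

definition center_independent :: "'i set \<Rightarrow> ('i \<Rightarrow> 'd::division_ring) \<Rightarrow> bool" where
  "center_independent I e \<longleftrightarrow>
     (\<forall>c. (\<Sum>i\<in>I. of_center (c i) * e i) = 0 \<longrightarrow> (\<forall>i\<in>I. c i = 0))"

lemma center_independent_subset:
  assumes "center_independent J e" "I \<subseteq> J" "finite J"
  shows "center_independent I e"
  unfolding center_independent_def
proof (intro allI impI)
  fix c assume c: "(\<Sum>i\<in>I. of_center (c i) * e i) = 0"
  define c' where "c' i = (if i \<in> I then c i else 0)" for i
  have "(\<Sum>i\<in>J. of_center (c' i) * e i) = (\<Sum>i\<in>I. of_center (c i) * e i)"
    by (rule sum.mono_neutral_cong_right)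
      (use assms in \<open>auto simp: c'_def zero_center.rep_eq\<close>)
  with c assms(1) have "\<forall>i\<in>J. c' i = 0" by (auto simp: center_independent_def)
  then show "\<forall>i\<in>I. c i = 0" using assms(2) by (metis c'_def subsetD)
qed

text \<open>The Jacobson density theorem for \<open>D\<close> as a bimodule over itself. If no operator separates
  \<open>e n\<close> from the others, then its values under their dual operators are central, and they
  express \<open>e n\<close> linearly through the others.\<close>

lemma dual_two_sided_op:
  fixes e :: "'i \<Rightarrow> 'd::division_ring"
  assumes "finite I" "center_independent I e" "n \<in> I"
  obtains ps where "two_sided_op ps (e n) = 1"
    "\<And>i. i \<in> I \<Longrightarrow> i \<noteq> n \<Longrightarrow> two_sided_op ps (e i) = 0"
proof -
  have "\<exists>ps. two_sided_op ps (e n) = 1 \<and> (\<forall>i\<in>I - {n}. two_sided_op ps (e i) = 0)"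
    using assms
  proof (induction "card I" arbitrary: I n rule: less_induct)
    case less
    define J where "J = I - {n}"
    have J: "finite J" "I = insert n J" "n \<notin> J"
      using less.prems by (auto simp: J_def)
    then have "card J < card I" by simp
    have indJ: "center_independent J e"
      using less.prems J by (blast intro: center_independent_subset)
    have "\<exists>ps. two_sided_op ps (e j) = 1 \<and> (\<forall>i\<in>J - {j}. two_sided_op ps (e i) = 0)"
      if "j \<in> J" for j
      using less.hyps[OF \<open>card J < card I\<close> J(1) indJ that, folded J_def] .
    then obtain T where T: "\<And>j. j \<in> J \<Longrightarrow> two_sided_op (T j) (e j) = 1"
      "\<And>i j. j \<in> J \<Longrightarrow> i \<in> J \<Longrightarrow> i \<noteq> j \<Longrightarrow> two_sided_op (T j) (e i) = 0"
      by (metis Diff_iff singletonD)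
    show ?case
    proof (cases "\<exists>ps. two_sided_op ps (e n) \<noteq> 0 \<and> (\<forall>i\<in>J. two_sided_op ps (e i) = 0)")
      case True
      then obtain ps where ps: "two_sided_op ps (e n) \<noteq> 0" "\<forall>i\<in>J. two_sided_op ps (e i) = 0"
        by blast
      show ?thesis
        by (rule exI[of _ "map (map_prod ((*) (inverse (two_sided_op ps (e n)))) id) ps"])
          (use ps in \<open>simp add: two_sided_scale_left[OF ring_hom_ident] flip: J_def\<close>)
    next
      case False
      \<comment> \<open>Subtracting from \<open>S\<close> the combination of the \<open>T j\<close>
        that agrees with it on \<open>J\<close> leaves an operator vanishing on \<open>J\<close>,
        hence also at \<open>e n\<close>.\<close>
      have expand: "two_sided_op S (e n)
          = (\<Sum>j\<in>J. two_sided_op S (e j) * two_sided_op (T j) (e n))" for S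
      proof -
        obtain qs where qs: "\<And>x. two_sided_op qs x
            = (\<Sum>j\<in>J. - two_sided_op S (e j) * two_sided_op (T j) x)"
          by (rule two_sided_linear_combination[OF ring_hom_ident, where I = J and R = T
                and w = "\<lambda>j. - two_sided_op S (e j)"]) (rule that)
        have "two_sided_op (S @ qs) (e i) = 0" if "i \<in> J" for i
        proof -
          have "(\<Sum>j\<in>J. - two_sided_op S (e j) * two_sided_op (T j) (e i))
            = (\<Sum>j\<in>J. if i = j then - two_sided_op S (e j) else 0)"
            using T that by (intro sum.cong) auto
          then show ?thesis using J that by (simp add: qs)
        qed
        with False have "two_sided_op (S @ qs) (e n) = 0" by blast
        then show ?thesis by (simp add: qs sum_negf)
      qed
      have "\<exists>c. two_sided_op (T j) (e n) = of_center c" if "j \<in> J" for j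
      proof -
        \<comment> \<open>Use \<open>expand\<close> for \<open>T j\<close> followed by right
          multiplication by \<open>d\<close>: its values on \<open>J\<close> are \<open>d\<close> at
          \<open>j\<close> and 0 elsewhere, which moves \<open>d\<close> to the left.\<close>
        have "d * two_sided_op (T j) (e n) = two_sided_op (T j) (e n) * d" for d
        proof -
          have "two_sided_op (T j) (e n) * d
            = (\<Sum>i\<in>J. two_sided_op (T j) (e i) * d * two_sided_op (T i) (e n))"
            using expand[of "map (map_prod id (\<lambda>x. x * d)) (T j)"]
            by (simp add: two_sided_scale_right[OF ring_hom_ident])
          also have "\<dots> = (\<Sum>i\<in>J. if i = j then d * two_sided_op (T i) (e n) else 0)"
            using T that by (intro sum.cong) auto
          finally show ?thesis using J that by simp
        qed
        then show ?thesis
          by (intro exI[of _ "to_center (two_sided_op (T j) (e n))"])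
            (subst to_center_inverse, auto)
      qed
      then obtain c where c: "\<And>j. j \<in> J \<Longrightarrow> two_sided_op (T j) (e n) = of_center (c j)"
        by metis
      \<comment> \<open>The list \<open>[(1, 1)]\<close> is the identity operator. The resulting
        relation, with coefficient \<open>- 1\<close> at \<open>n\<close>, contradicts
        independence.\<close>
      have "e n = (\<Sum>j\<in>J. e j * of_center (c j))"
        using expand[of "[(1, 1)]"] c by simp
      also have "\<dots> = (\<Sum>j\<in>J. of_center (c j) * e j)"
        by (intro sum.cong refl) (rule of_center_commute[symmetric])
      also have "\<dots> = (\<Sum>j\<in>J. of_center ((c(n := - 1)) j) * e j)"
        by (rule sum.cong) (use J in auto)
      finally have "(\<Sum>i\<in>I. of_center ((c(n := - 1)) i) * e i) = 0"
        using J by (simp add: uminus_center.rep_eq one_center.rep_eq)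
      then have "(c(n := - 1)) n = 0"
        using less.prems unfolding center_independent_def by blast
      then show ?thesis by simp
    qed
  qed
  then show ?thesis using that by auto
qed

text \<open>If some \<open>c j\<close> in a relation is nonzero, the remaining \<open>N - 1\<close>
  members of the family already span, against the dimension. The family is indexed, so equal values
  at two indices also count as a relation.\<close>

lemma center_independentI:
  fixes e :: "nat \<Rightarrow> 'd::division_ring"
  assumes dim: "vector_space.dim center_scale (UNIV :: 'd set) = N"
    and span: "\<And>d. \<exists>c. d = (\<Sum>i<N. of_center (c i) * e i)"
  shows "center_independent {..<N} e"
proof -
  interpret V: vector_space "center_scale :: 'd center \<Rightarrow> _" by (rule vector_space_center_scale)
  show ?thesis unfolding center_independent_def
  proof (intro allI impI ballI, rule ccontr)
    fix c j assume c: "(\<Sum>i<N. of_center (c i) * e i) = 0" and j: "j \<in> {..<N}" "c j \<noteq> 0"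
    let ?B = "e ` ({..<N} - {j})"
    have sum_in: "(\<Sum>i\<in>{..<N} - {j}. of_center (b i) * e i) \<in> V.span ?B" for b
    proof (rule V.span_sum)
      fix i assume "i \<in> {..<N} - {j}"
      then have "center_scale (b i) (e i) \<in> V.span ?B"
        by (intro V.span_scale V.span_base imageI)
      then show "of_center (b i) * e i \<in> V.span ?B" by (simp add: center_scale_def)
    qed
    have "of_center (c j) * e j = - (\<Sum>i\<in>{..<N} - {j}. of_center (c i) * e i)"
      using c j by (simp add: sum.remove eq_neg_iff_add_eq_0)
    then have "center_scale (c j) (e j) \<in> V.span ?B"
      using V.span_neg[OF sum_in] by (simp add: center_scale_def)
    then have "center_scale (inverse (c j)) (center_scale (c j) (e j)) \<in> V.span ?B"
      by (rule V.span_scale)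
    then have ej: "e j \<in> V.span ?B" using j by simp
    have "UNIV \<subseteq> V.span ?B"
    proof
      fix d :: 'd
      obtain b where "d = (\<Sum>i<N. of_center (b i) * e i)" using span by blast
      then have "d = of_center (b j) * e j + (\<Sum>i\<in>{..<N} - {j}. of_center (b i) * e i)"
        using j by (simp add: sum.remove)
      then show "d \<in> V.span ?B"
        using V.span_add[OF V.span_scale[OF ej] sum_in] by (simp add: center_scale_def)
    qed
    then have "V.dim UNIV \<le> card ?B" by (rule V.dim_le_card) simp
    also have "\<dots> \<le> card ({..<N} - {j})" by (rule card_image_le) simp
    also have "\<dots> < N" using j by (simp)
    finally show False using dim by simp
  qed
qed

section \<open>Bijectivity of \<open>h\<close>\<close>

text \<open>The ring is generated by the constants and \<open>gp_z\<close>: agreement there gives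
  agreement on words, and then on all integer combinations of words.\<close>

lemma gpoly_hom_unique:
  assumes "Ring_Hom.ring_hom F" "Ring_Hom.ring_hom G"
    and const: "\<And>d. F (gp_const d) = G (gp_const d)" and z: "F gp_z = G gp_z"
  shows "F = G"
proof
  fix x :: "'a gpoly"
  interpret F: Ring_Hom.ring_hom F by fact
  interpret G: Ring_Hom.ring_hom G by fact
  have word: "F (abs_gpoly (Poly_Mapping.single (Word xs) 1))
      = G (abs_gpoly (Poly_Mapping.single (Word xs) 1))" for xs
  proof (induction xs)
    case Nil
    have "abs_gpoly (Poly_Mapping.single (Word [] :: 'a option free_monoid) 1) = 1"
      by (simp add: one_gpoly_def flip: zero_free_monoid_def)
    then show ?case by simp
  next
    case (Cons y ys)
    have "Poly_Mapping.single (Word (y # ys)) (1 :: int)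
        = Poly_Mapping.single (Word [y]) 1 * Poly_Mapping.single (Word ys) 1"
      by (simp add: mult_single plus_free_monoid_def)
    then have eq: "abs_gpoly (Poly_Mapping.single (Word (y # ys)) (1 :: int))
        = abs_gpoly (Poly_Mapping.single (Word [y]) 1) * abs_gpoly (Poly_Mapping.single (Word ys) 1)"
      by (simp add: times_gpoly.abs_eq)
    have "F (abs_gpoly (Poly_Mapping.single (Word [y]) 1))
        = G (abs_gpoly (Poly_Mapping.single (Word [y]) 1))"
      using const z by (cases y)
        (auto simp: gp_const.abs_eq pre_const_def gp_z_def pre_z_def)
    with Cons show ?case by (simp add: eq F.hom_mult G.hom_mult)
  qed
  have "F (abs_gpoly f) = G (abs_gpoly f)" for f :: "'a pre_gpoly"
  proof (rule frag_induction[of f UNIV])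
    show "F (abs_gpoly 0) = G (abs_gpoly 0)" by (simp flip: zero_gpoly_def)
    show "F (abs_gpoly (frag_of w)) = G (abs_gpoly (frag_of w))" for w
      using word[of "letters w"] by simp
    show "F (abs_gpoly (f - g)) = G (abs_gpoly (f - g))"
      if "F (abs_gpoly f) = G (abs_gpoly f)" "F (abs_gpoly g) = G (abs_gpoly g)"
      for f g :: "'a pre_gpoly"
      using that by (simp add: F.hom_minus G.hom_minus flip: minus_gpoly.abs_eq)
  qed simp
  from this[of "rep_gpoly x"] show "F x = G x"
    by (simp add: Quotient_abs_rep[OF Quotient_gpoly])
qed

section \<open>Evaluation homomorphisms on monoid rings\<close>

lemma poly_mapping_sum_single:
  "(\<Sum>m\<in>Poly_Mapping.keys f. Poly_Mapping.single m (Poly_Mapping.lookup f m)) = f"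
  by (rule poly_mapping_eqI)
    (simp add: lookup_sum lookup_single when_def in_keys_iff)

lemma poly_mapping_induct_add [case_names zero single add]:
  fixes f :: "'m \<Rightarrow>\<^sub>0 'c::comm_monoid_add"
  assumes "P 0" "\<And>m c. P (Poly_Mapping.single m c)" "\<And>f g. P f \<Longrightarrow> P g \<Longrightarrow> P (f + g)"
  shows "P f"
proof -
  have "P (\<Sum>m\<in>M. Poly_Mapping.single m (Poly_Mapping.lookup f m))" if "finite M" for M
    using that by induction (auto intro: assms)
  from this[of "Poly_Mapping.keys f"] show ?thesis by (simp add: poly_mapping_sum_single)
qed

text \<open>Serves both polynomial rings: \<open>'m\<close> is the monoid of words for noncommuting
  variables and that of multisets for commuting ones.\<close>

definition mon_eval :: "('c::zero \<Rightarrow> 'r::semiring_0) \<Rightarrow> ('m \<Rightarrow> 'r) \<Rightarrow> ('m \<Rightarrow>\<^sub>0 'c) \<Rightarrow> 'r" where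
  "mon_eval \<phi> \<chi> f = (\<Sum>m\<in>Poly_Mapping.keys f. \<phi> (Poly_Mapping.lookup f m) * \<chi> m)"

text \<open>In a product of two terms the coefficient of the second has to pass the monomial of the
  first; \<open>comm\<close> permits this after evaluation.\<close>

lemma ring_hom_mon_eval:
  fixes \<phi> :: "'c::ring_1 \<Rightarrow> 'r::ring_1" and \<chi> :: "'m::monoid_add \<Rightarrow> 'r"
  assumes "Ring_Hom.ring_hom \<phi>" and \<chi>: "\<chi> 0 = 1" "\<And>u v. \<chi> (u + v) = \<chi> u * \<chi> v"
    and comm: "\<And>c m. \<phi> c * \<chi> m = \<chi> m * \<phi> c"
  shows "Ring_Hom.ring_hom (mon_eval \<phi> \<chi>)"
    and "mon_eval \<phi> \<chi> (Poly_Mapping.single m c) = \<phi> c * \<chi> m"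
proof -
  interpret Ring_Hom.ring_hom \<phi> by fact
  have eval_single: "mon_eval \<phi> \<chi> (Poly_Mapping.single m c) = \<phi> c * \<chi> m" for m c
    by (simp add: mon_eval_def)
  then show "mon_eval \<phi> \<chi> (Poly_Mapping.single m c) = \<phi> c * \<chi> m" .
  have zero: "mon_eval \<phi> \<chi> 0 = 0" by (simp add: mon_eval_def)
  have add: "mon_eval \<phi> \<chi> (f + g) = mon_eval \<phi> \<chi> f + mon_eval \<phi> \<chi> g" for f g
    unfolding mon_eval_def
    by (rule setsum_keys_plus_distrib) (simp_all add: hom_distribs distrib_right)
  have single_mult: "mon_eval \<phi> \<chi> (Poly_Mapping.single m c * g)
      = mon_eval \<phi> \<chi> (Poly_Mapping.single m c) * mon_eval \<phi> \<chi> g" for m c g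
  proof (induction g rule: poly_mapping_induct_add)
    case (single n d)
    have "\<phi> c * (\<phi> d * (\<chi> m * \<chi> n)) = \<phi> c * (\<chi> m * (\<phi> d * \<chi> n))"
      by (metis comm mult.assoc)
    then show ?case by (simp add: mult_single assms(3) eval_single hom_mult mult.assoc)
  qed (simp_all add: zero add distrib_left)
  have mult: "mon_eval \<phi> \<chi> (f * g) = mon_eval \<phi> \<chi> f * mon_eval \<phi> \<chi> g" for f g
    by (induction f rule: poly_mapping_induct_add)
      (simp_all add: zero add distrib_right single_mult)
  have one: "mon_eval \<phi> \<chi> 1 = 1" using eval_single[of 0 1] by (simp add: \<chi>)
  show "Ring_Hom.ring_hom (mon_eval \<phi> \<chi>)"
    by unfold_locales (simp_all add: zero one add mult)
qed

definition nc_eval :: "('d::division_ring \<Rightarrow> 'r::ring_1) \<Rightarrow> (nat \<Rightarrow> 'r) \<Rightarrow> 'd ncpoly \<Rightarrow> 'r" where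
  "nc_eval \<phi> y = mon_eval \<phi> (\<lambda>w. prod_list (map y (letters w)))"

lemma nc_eval:
  assumes "Ring_Hom.ring_hom \<phi>" and comm: "\<And>c i. \<phi> c * y i = y i * \<phi> c"
  shows "Ring_Hom.ring_hom (nc_eval \<phi> y)"
    and "nc_eval \<phi> y (Poly_Mapping.single w c) = \<phi> c * prod_list (map y (letters w))"
    and "nc_eval \<phi> y (nc_const c) = \<phi> c"
    and "nc_eval \<phi> y (nc_var i) = y i"
proof -
  interpret Ring_Hom.ring_hom \<phi> by fact
  have "\<phi> c * prod_list (map y xs) = prod_list (map y xs) * \<phi> c" for c xs
  proof (induction xs)
    case (Cons x xs)
    then show ?case by (simp add: mult.assoc) (metis comm mult.assoc)
  qed simp
  note hom = ring_hom_mon_eval[OF assms(1) _ _ this, of letters]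
  have *: "Ring_Hom.ring_hom (nc_eval \<phi> y)"
      "nc_eval \<phi> y (Poly_Mapping.single w c) = \<phi> c * prod_list (map y (letters w))" for w c
    unfolding nc_eval_def
    by (rule hom; simp add: zero_free_monoid_def plus_free_monoid_def)+
  then show "Ring_Hom.ring_hom (nc_eval \<phi> y)"
    "nc_eval \<phi> y (Poly_Mapping.single w c) = \<phi> c * prod_list (map y (letters w))" by blast+
  show "nc_eval \<phi> y (nc_const c) = \<phi> c" "nc_eval \<phi> y (nc_var i) = y i"
    by (simp_all add: * nc_const_def nc_var_def zero_free_monoid_def)
qed

section \<open>Constants and relations in the two polynomial rings\<close>

lemma ring_hom_nc_const: "Ring_Hom.ring_hom (nc_const :: 'd::division_ring \<Rightarrow> 'd ncpoly)"
  by unfold_locales (simp_all add: nc_const_def single_add mult_single)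

lemma gpoly_eqI: "f - g \<in> gp_relations \<Longrightarrow> abs_gpoly f = abs_gpoly g"
  by (rule Quotient_rel_abs[OF Quotient_gpoly]) (simp add: gp_rel_def gp_relations_ideal)

lemma ring_hom_gp_const: "Ring_Hom.ring_hom (gp_const :: 'd::division_ring \<Rightarrow> 'd gpoly)"
proof -
  have one: "gp_const 1 = (1 :: 'd gpoly)"
    unfolding gp_const.abs_eq one_gpoly_def by (rule gpoly_eqI) (simp add: gp_relations_def)
  have add: "gp_const (x + y) = gp_const x + gp_const y" for x y :: 'd
    unfolding gp_const.abs_eq plus_gpoly.abs_eq
    by (rule gpoly_eqI) (auto simp only: gp_relations_def Un_iff)
  have mult: "gp_const (x * y) = gp_const x * gp_const y" for x y :: 'd
    unfolding gp_const.abs_eq times_gpoly.abs_eq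
    by (rule gpoly_eqI) (auto simp only: gp_relations_def Un_iff)
  have "gp_const 0 + gp_const 0 = gp_const (0 :: 'd)" by (simp flip: add)
  then have zero: "gp_const 0 = (0 :: 'd gpoly)" by simp
  show ?thesis by unfold_locales (rule one zero add mult)+
qed

lemma gp_z_center_commute: "gp_const (of_center c) * gp_z = gp_z * gp_const (of_center c)"
  unfolding gp_const.abs_eq gp_z_def times_gpoly.abs_eq
  by (rule gpoly_eqI) (auto simp only: gp_relations_def Un_iff)

lemma nc_const_mult_var: "nc_const d * nc_var i = nc_var i * nc_const d"
  by (simp add: nc_const_def nc_var_def mult_single)

lemma nc_single_eq:
  fixes d :: "'d::division_ring"
  shows "Poly_Mapping.single w d = nc_const d * prod_list (map nc_var (letters w))"
proof -
  have "prod_list (map nc_var xs) = (Poly_Mapping.single (Word xs) 1 :: 'd ncpoly)" for xs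
    by (induction xs)
      (simp_all add: nc_var_def mult_single plus_free_monoid_def flip: zero_free_monoid_def)
  then show ?thesis by (simp add: nc_const_def mult_single)
qed

lemma two_sided_hom:
  assumes "Ring_Hom.ring_hom F"
  shows "F (two_sided \<phi> t ps) = two_sided (\<lambda>d. F (\<phi> d)) (F t) ps"
proof -
  interpret Ring_Hom.ring_hom F by fact
  show ?thesis by (induction ps) (auto simp: hom_distribs)
qed

text \<open>Both sides are the double sum of \<open>u * r * v * s\<close>. Thus coordinates of the
  right factors of \<open>ps\<close>, when computed by an operator \<open>qs\<close>, turn into
  values of the operator of \<open>ps\<close>.\<close>

lemma two_sided_op_swap:
  "(\<Sum>(u, v)\<leftarrow>ps. u * two_sided_op qs v) = (\<Sum>(r, s)\<leftarrow>qs. two_sided_op ps r * s)"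
proof (induction ps)
  case Nil
  show ?case by (induction qs) auto
next
  case (Cons p ps)
  have "u * two_sided_op qs v + (\<Sum>(r, s)\<leftarrow>qs. two_sided_op ps r * s)
    = (\<Sum>(r, s)\<leftarrow>qs. two_sided_op ((u, v) # ps) r * s)" for u v
    by (induction qs) (auto simp: algebra_simps)
  with Cons show ?case by (cases p) simp
qed

section \<open>Dual operators of a basis over the center\<close>

locale center_basis =
  fixes N :: nat and e :: "nat \<Rightarrow> 'd::division_ring"
  assumes independent: "center_independent {..<N} e"
    and spanning: "\<exists>c. d = (\<Sum>i<N. of_center (c i) * e i)"
begin

definition dual :: "nat \<Rightarrow> ('d \<times> 'd) list" where
  "dual i = (SOME ps. two_sided_op ps (e i) = 1 \<and> (\<forall>j\<in>{..<N} - {i}. two_sided_op ps (e j) = 0))"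

lemma dual: "i < N \<Longrightarrow> j < N \<Longrightarrow> two_sided_op (dual i) (e j) = (if i = j then 1 else 0)"
proof -
  assume "i < N" "j < N"
  moreover from this have "\<exists>ps. two_sided_op ps (e i) = 1 \<and> (\<forall>j\<in>{..<N} - {i}. two_sided_op ps (e j) = 0)"
    using dual_two_sided_op[OF _ independent, of i] by (metis Diff_iff finite_lessThan lessThan_iff singletonI)
  from someI_ex[OF this, folded dual_def] show ?thesis using \<open>j < N\<close> by auto
qed

text \<open>Multiplication operators are linear over the center, so \<open>dual i\<close> reads off
  the coordinate at \<open>e i\<close>; in particular its values are central.\<close>

lemma dual_coordinate:
  assumes "d = (\<Sum>j<N. of_center (c j) * e j)" "i < N"
  shows "two_sided_op (dual i) d = of_center (c i)"
proof -
  have "two_sided_op (dual i) d = (\<Sum>j<N. if i = j then of_center (c j) else 0)"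
    unfolding assms(1) two_sided_op_sum two_sided_op_center
    by (rule sum.cong) (use assms(2) in \<open>auto simp: dual\<close>)
  then show ?thesis using assms(2) by simp
qed

lemma dual_central: "i < N \<Longrightarrow> \<exists>c. two_sided_op (dual i) d = of_center c"
  using dual_coordinate spanning by metis

lemma dual_expansion: "(\<Sum>i<N. two_sided_op (dual i) d * e i) = d"
proof -
  obtain c where c: "d = (\<Sum>j<N. of_center (c j) * e j)" using spanning by blast
  then show ?thesis using dual_coordinate[OF c] by simp
qed

text \<open>Multiplication operators satisfy no more relations than the elements \<open>u \<otimes> v\<close> over the
  center: the coefficients in the basis \<open>e\<close> of the right factors are themselves obtained from the
  operator.\<close>

lemma two_sided_eq_0:
  assumes "Ring_Hom.ring_hom (\<phi> :: 'd \<Rightarrow> 'r::ring_1)"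
    and comm: "\<And>c. \<phi> (of_center c) * t = t * \<phi> (of_center c)"
    and ps: "\<And>d. two_sided_op ps d = 0"
  shows "two_sided \<phi> t ps = 0"
proof -
  interpret Ring_Hom.ring_hom \<phi> by fact
  \<comment> \<open>Each right factor is expanded in the basis; its coordinates are central, so they
    can be moved across \<open>t\<close> to the left factor.\<close>
  have expand: "two_sided \<phi> t qs
    = (\<Sum>i<N. \<phi> (\<Sum>(u, v)\<leftarrow>qs. u * two_sided_op (dual i) v) * t * \<phi> (e i))" for qs
  proof (induction qs)
    case (Cons q qs)
    obtain u v where q: "q = (u, v)" by force
    have "\<phi> u * t * \<phi> v = \<phi> u * t * \<phi> (\<Sum>i<N. two_sided_op (dual i) v * e i)"
      by (simp add: dual_expansion)
    also have "\<dots> = (\<Sum>i<N. \<phi> (u * two_sided_op (dual i) v) * t * \<phi> (e i))"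
      unfolding hom_sum sum_distrib_left
    proof (rule sum.cong)
      fix i assume "i \<in> {..<N}"
      then obtain c where "two_sided_op (dual i) v = of_center c" using dual_central by blast
      then show "\<phi> u * t * \<phi> (two_sided_op (dual i) v * e i)
          = \<phi> (u * two_sided_op (dual i) v) * t * \<phi> (e i)"
        by (simp add: hom_mult) (metis comm mult.assoc)
    qed simp
    finally show ?case
      by (simp add: q Cons hom_add distrib_right sum.distrib)
  qed simp
  have "(\<Sum>(u, v)\<leftarrow>ps. u * two_sided_op (dual i) v) = 0" for i
    unfolding two_sided_op_swap by (simp add: ps case_prod_unfold)
  then show ?thesis by (simp add: expand)
qed

text \<open>The preimage of the variable \<open>x\<^sub>i\<close> under \<open>h\<close>. The value \<open>0\<close> at the unused indices ensures that
  every \<open>gp_coord i\<close> commutes with the constants.\<close>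

definition gp_coord :: "nat \<Rightarrow> 'd gpoly" where
  "gp_coord i = (if i \<in> {1..N} then two_sided gp_const gp_z (dual (i - 1)) else 0)"

text \<open>For an index in range, \<open>?ps\<close> represents \<open>d\<close> times the dual
  operator minus the dual operator times \<open>d\<close>. It acts as zero because the dual values
  are central, and \<open>two_sided_eq_0\<close> transfers this to general polynomials.\<close>

lemma gp_coord_commute: "gp_const d * gp_coord i = gp_coord i * gp_const d"
proof (cases "i \<in> {1..N}")
  case True
  let ?p = "dual (i - 1)"
  let ?ps = "map (map_prod ((*) d) id) ?p @ map (map_prod id (\<lambda>x. x * d)) (map (map_prod ((*) (- 1)) id) ?p)"
  have "two_sided_op ?ps x = 0" for x
  proof -
    obtain c where "two_sided_op ?p x = of_center c"
      using dual_central[of "i - 1" x] True by fastforce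
    then show ?thesis
      by (simp only: two_sided_simps two_sided_scale_left[OF ring_hom_ident]
          two_sided_scale_right[OF ring_hom_ident]) (simp add: of_center_commute)
  qed
  from two_sided_eq_0[OF ring_hom_gp_const gp_z_center_commute this]
  have eq: "two_sided gp_const gp_z ?ps = 0" .
  interpret g: Ring_Hom.ring_hom "gp_const :: 'd \<Rightarrow> _" by (rule ring_hom_gp_const)
  from eq show ?thesis using True
    by (simp only: two_sided_simps two_sided_scale_left[OF ring_hom_gp_const]
        two_sided_scale_right[OF ring_hom_gp_const])
      (simp add: gp_coord_def g.hom_uminus)
qed (auto simp: gp_coord_def)

text \<open>By expansion in the basis, the dual operators with coefficients \<open>e i\<close> add
  up to the identity. The appended pair \<open>(- 1, 1)\<close> subtracts the identity, so that
  \<open>two_sided_eq_0\<close> applies.\<close>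

lemma sum_gp_coord: "(\<Sum>i<N. gp_const (e i) * gp_coord (Suc i)) = gp_z"
proof -
  obtain qs where qs: "\<And>x. two_sided_op qs x = (\<Sum>i<N. e i * two_sided_op (dual i) x)"
    "\<And>t. two_sided gp_const t qs = (\<Sum>i<N. gp_const (e i) * two_sided gp_const t (dual i))"
    by (rule two_sided_linear_combination[OF ring_hom_gp_const, where I = "{..<N}" and R = dual and w = e])
      (rule that)
  interpret g: Ring_Hom.ring_hom "gp_const :: 'd \<Rightarrow> _" by (rule ring_hom_gp_const)
  have "two_sided_op (qs @ [(- 1, 1)]) d = 0" for d
  proof -
    have "(\<Sum>i<N. e i * two_sided_op (dual i) d) = (\<Sum>i<N. two_sided_op (dual i) d * e i)"
    proof (rule sum.cong)
      fix i assume "i \<in> {..<N}"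
      then obtain c where "two_sided_op (dual i) d = of_center c" using dual_central by blast
      then show "e i * two_sided_op (dual i) d = two_sided_op (dual i) d * e i"
        by (simp add: of_center_commute)
    qed simp
    then show ?thesis by (simp add: qs dual_expansion)
  qed
  from two_sided_eq_0[OF ring_hom_gp_const gp_z_center_commute this]
  show ?thesis by (simp add: qs g.hom_uminus gp_coord_def)
qed

definition gp_of_nc :: "'d ncpoly \<Rightarrow> 'd gpoly" where
  "gp_of_nc = nc_eval gp_const gp_coord"

lemmas gp_of_nc = nc_eval[OF ring_hom_gp_const, of gp_coord, OF gp_coord_commute, folded gp_of_nc_def]

end

section \<open>The inverse of \<open>h\<close>, and substitution in terms of coordinates\<close>

locale general_polynomials = center_basis +
  fixes a assumes N_pos: "N > 0" and e_eq: "e = a(0 := 1)"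
begin

text \<open>With 1 in slot 0 of \<open>e\<close>, the special first summand of \<open>h\<close>
  joins the others; \<open>e i\<close> goes with the variable of index \<open>Suc i\<close>.\<close>

lemma gp_h_z: "gp_h N a gp_z = (\<Sum>i<N. nc_const (e i) * nc_var (Suc i))"
proof -
  have "{..<N} = insert 0 {1..<N}" using N_pos by auto
  then have "(\<Sum>i<N. nc_const (e i) * nc_var (Suc i))
    = nc_const 1 * nc_var (Suc 0) + (\<Sum>i=1..<N. nc_const (a i) * nc_var (Suc i))"
    by (simp add: e_eq)
  then show ?thesis by (simp add: gp_h nc_const_def)
qed

text \<open>The composite is a homomorphism fixing the constants and, by
  \<open>sum_gp_coord\<close>, also \<open>gp_z\<close>; uniqueness makes it the identity.\<close>

lemma gp_of_nc_gp_h: "gp_of_nc (gp_h N a P) = P"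
proof -
  interpret h: Ring_Hom.ring_hom "gp_h N a" by (rule gp_h)
  interpret g: Ring_Hom.ring_hom gp_of_nc by (rule gp_of_nc)
  have "(\<lambda>P. gp_of_nc (gp_h N a P)) = (\<lambda>P. P)"
  proof (rule gpoly_hom_unique[OF _ ring_hom_ident])
    show "Ring_Hom.ring_hom (\<lambda>P. gp_of_nc (gp_h N a P))"
      by unfold_locales (simp_all add: h.hom_add g.hom_add h.hom_mult g.hom_mult)
    show "gp_of_nc (gp_h N a (gp_const d)) = gp_const d" for d by (simp add: gp_h gp_of_nc)
    show "gp_of_nc (gp_h N a gp_z) = gp_z"
      by (simp add: gp_h_z g.hom_sum g.hom_mult gp_of_nc sum_gp_coord)
  qed
  then show ?thesis by metis
qed

text \<open>Variables commute with constants in the target, so the list \<open>dual (i - 1)\<close>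
  acts on the coefficients \<open>e j\<close> of the image of \<open>gp_z\<close> and leaves a
  single variable.\<close>

lemma gp_h_coord:
  assumes "i \<in> {1..N}"
  shows "gp_h N a (gp_coord i) = nc_var i"
proof -
  have *: "two_sided nc_const (gp_h N a gp_z) ps
      = (\<Sum>j<N. nc_const (two_sided_op ps (e j)) * nc_var (Suc j))" for ps
  proof (induction ps)
    case Nil
    show ?case by (simp add: nc_const_def)
  next
    case (Cons p ps)
    interpret c: Ring_Hom.ring_hom "nc_const :: 'a \<Rightarrow> _" by (rule ring_hom_nc_const)
    obtain u v where p: "p = (u, v)" by force
    have "nc_const u * gp_h N a gp_z * nc_const v
        = (\<Sum>j<N. nc_const (u * e j * v) * nc_var (Suc j))"
      unfolding gp_h_z sum_distrib_left sum_distrib_right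
    proof (rule sum.cong)
      fix j
      show "nc_const u * (nc_const (e j) * nc_var (Suc j)) * nc_const v
        = nc_const (u * e j * v) * nc_var (Suc j)"
        by (simp add: c.hom_mult mult.assoc) (metis nc_const_mult_var)
    qed simp
    with Cons show ?case by (simp add: p c.hom_add distrib_right sum.distrib)
  qed
  have "gp_h N a (gp_coord i) = (\<Sum>j<N. nc_const (two_sided_op (dual (i - 1)) (e j)) * nc_var (Suc j))"
    using assms by (simp add: gp_coord_def two_sided_hom[OF gp_h(1)] gp_h(2) *)
  also have "\<dots> = (\<Sum>j<N. if j = i - 1 then nc_var (Suc j) else 0)"
    by (rule sum.cong) (use assms in \<open>auto simp: dual nc_const_def\<close>)
  also have "\<dots> = nc_var i" using assms by (cases i) auto
  finally show ?thesis .
qed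

text \<open>The type \<open>ncpoly\<close> has variables of every natural index, and
  \<open>gp_coord\<close> is 0 outside \<open>{1..N}\<close>; hence the condition on the words of
  \<open>q\<close>.\<close>

lemma gp_h_gp_of_nc:
  assumes "\<And>w. w \<in> Poly_Mapping.keys q \<Longrightarrow> set (letters w) \<subseteq> {1..N}"
  shows "gp_h N a (gp_of_nc q) = q"
proof -
  interpret h: Ring_Hom.ring_hom "gp_h N a" by (rule gp_h)
  have "gp_h N a (gp_of_nc q) = (\<Sum>w\<in>Poly_Mapping.keys q.
      nc_const (Poly_Mapping.lookup q w) * prod_list (map (gp_h N a \<circ> gp_coord) (letters w)))"
    by (simp add: gp_of_nc_def nc_eval_def mon_eval_def h.hom_sum h.hom_mult gp_h h.hom_prod_list)
  also have "\<dots> = (\<Sum>w\<in>Poly_Mapping.keys q. Poly_Mapping.single w (Poly_Mapping.lookup q w))"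
  proof (rule sum.cong)
    fix w assume w: "w \<in> Poly_Mapping.keys q"
    have "map (gp_h N a \<circ> gp_coord) (letters w) = map nc_var (letters w)"
      using assms[OF w] by (intro map_cong) (auto simp: gp_h_coord)
    then show "nc_const (Poly_Mapping.lookup q w) * prod_list (map (gp_h N a \<circ> gp_coord) (letters w))
      = Poly_Mapping.single w (Poly_Mapping.lookup q w)"
      by (simp only: nc_single_eq)
  qed simp
  finally show ?thesis by (simp add: poly_mapping_sum_single)
qed

text \<open>Since \<open>gp_h N a\<close> is injective and \<open>q\<close> is one of its values,
  the \<open>inv\<close> in \<open>gp_char_poly\<close> yields the actual preimage.\<close>

lemma inv_gp_h:
  assumes "\<And>w. w \<in> Poly_Mapping.keys q \<Longrightarrow> set (letters w) \<subseteq> {1..N}"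
  shows "inv_into UNIV (gp_h N a) q = gp_of_nc q"
proof -
  have "inj (gp_h N a)" by (rule inj_on_inverseI) (rule gp_of_nc_gp_h)
  then show ?thesis using gp_h_gp_of_nc[OF assms] by (metis inv_f_f)
qed

text \<open>Substitution of \<open>l\<close> and evaluation at the coordinates after
  \<open>h\<close> are two homomorphisms that fix the constants and send \<open>gp_z\<close> to
  \<open>l\<close>, so they coincide.\<close>

lemma gp_subst_gp_of_nc:
  assumes "l = (\<Sum>i<N. of_center (c i) * e i)"
    and "\<And>w. w \<in> Poly_Mapping.keys q \<Longrightarrow> set (letters w) \<subseteq> {1..N}"
  shows "gp_subst l (gp_of_nc q) = nc_eval (\<lambda>d. d) (\<lambda>i. of_center (c (i - 1))) q"
proof -
  \<comment> \<open>Variable \<open>i\<close> belongs to slot \<open>i - 1\<close> of the basis. The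
    values are central, as \<open>nc_eval\<close> requires.\<close>
  define y where "y i = of_center (c (i - 1))" for i
  let ?E = "nc_eval (\<lambda>d. d) y"
  have "d * y i = y i * d" for d i by (simp add: y_def of_center_commute)
  note E = nc_eval[OF ring_hom_ident, of y, OF this]
  interpret E: Ring_Hom.ring_hom ?E by (rule E)
  interpret h: Ring_Hom.ring_hom "gp_h N a" by (rule gp_h)
  have "gp_subst l = (\<lambda>P. ?E (gp_h N a P))"
  proof (rule gpoly_hom_unique[OF gp_subst(1)])
    show "Ring_Hom.ring_hom (\<lambda>P. ?E (gp_h N a P))"
      by unfold_locales (simp_all add: h.hom_add E.hom_add h.hom_mult E.hom_mult)
    show "gp_subst l (gp_const d) = ?E (gp_h N a (gp_const d))" for d
      by (simp add: gp_subst gp_h E)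
    show "gp_subst l gp_z = ?E (gp_h N a gp_z)"
      by (simp add: gp_subst gp_h_z E.hom_sum E.hom_mult E assms(1) y_def of_center_commute)
  qed
  then show ?thesis by (simp add: gp_h_gp_of_nc[OF assms(2)] y_def[abs_def])
qed

end

section \<open>The grading\<close>

abbreviation gp_monomial :: "'d::division_ring \<Rightarrow> 'd list \<Rightarrow> 'd gpoly" where
  "gp_monomial b bs \<equiv> gp_const b * prod_list (map (\<lambda>b'. gp_z * gp_const b') bs)"

lemma gp_monomial_component: "gp_monomial b bs \<in> gp_component (length bs)"
  using gp_component.add_monomial[OF gp_component.zero refl, of b bs] by simp

text \<open>The extra constant is absorbed into the last one. Hence a product of two monomials is
  again a monomial, with the lengths added.\<close>

lemma gp_monomial_mult_const:
  "\<exists>b' bs'. length bs' = length bs \<and> gp_monomial b bs * gp_const d = gp_monomial b' bs'"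
proof -
  interpret g: Ring_Hom.ring_hom "gp_const :: 'a \<Rightarrow> _" by (rule ring_hom_gp_const)
  show ?thesis
  proof (cases bs rule: rev_cases)
    case Nil
    then show ?thesis by (intro exI[of _ "b * d"] exI[of _ "[]"]) (simp add: g.hom_mult)
  next
    case (snoc cs c)
    then show ?thesis
      by (intro exI[of _ b] exI[of _ "cs @ [c * d]"]) (simp add: g.hom_mult mult.assoc)
  qed
qed

lemma gp_component_add: "P \<in> gp_component n \<Longrightarrow> Q \<in> gp_component n \<Longrightarrow> P + Q \<in> gp_component n"
  by (induction rule: gp_component.induct) (auto simp: add.assoc intro: gp_component.add_monomial)

lemma gp_component_sum: "(\<And>i. i \<in> I \<Longrightarrow> f i \<in> gp_component n) \<Longrightarrow> sum f I \<in> gp_component n"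
  by (induction I rule: infinite_finite_induct) (auto intro: gp_component.zero gp_component_add)

lemma gp_component_mult:
  assumes "P \<in> gp_component m" "Q \<in> gp_component n"
  shows "P * Q \<in> gp_component (m + n)"
  using assms(1)
proof induction
  case zero
  show ?case by (simp add: gp_component.zero)
next
  case (add_monomial P bs b)
  have "gp_monomial b bs * Q \<in> gp_component (m + n)"
    using assms(2)
  proof induction
    case zero
    show ?case by (simp add: gp_component.zero)
  next
    case (add_monomial Q cs c)
    obtain b' bs' where b': "length bs' = length bs" "gp_monomial b bs * gp_const c = gp_monomial b' bs'"
      using gp_monomial_mult_const by blast
    have "gp_monomial b bs * gp_monomial c cs = gp_monomial b' (bs' @ cs)"
      by (simp only: b'(2) flip: mult.assoc) (simp add: mult.assoc)
    moreover have "length (bs' @ cs) = m + n" using b' add_monomial \<open>length bs = m\<close> by simp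
    ultimately have "gp_monomial b bs * gp_monomial c cs \<in> gp_component (m + n)"
      by (metis gp_monomial_component)
    with add_monomial show ?case by (simp add: distrib_left gp_component_add)
  qed
  with add_monomial show ?case by (simp add: distrib_right gp_component_add)
qed

lemma two_sided_gp_component: "two_sided gp_const gp_z ps \<in> gp_component 1"
proof (induction ps)
  case (Cons p ps)
  have "gp_const u * gp_z * gp_const v \<in> gp_component 1" for u v :: 'a
    using gp_monomial_component[of u "[v]"] by (simp add: mult.assoc)
  with Cons show ?case by (cases p) (simp add: gp_component_add)
qed (simp add: gp_component.zero)

section \<open>Supports, word length and the degree\<close>

lemma keys_mult_subset:
  assumes "Poly_Mapping.keys f \<subseteq> S" "Poly_Mapping.keys g \<subseteq> T" "\<And>u v. u \<in> S \<Longrightarrow> v \<in> T \<Longrightarrow> u + v \<in> U"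
  shows "Poly_Mapping.keys (f * g) \<subseteq> U"
  using keys_mult[of f g] assms by blast

lemma keys_add_subset:
  "Poly_Mapping.keys f \<subseteq> S \<Longrightarrow> Poly_Mapping.keys g \<subseteq> S \<Longrightarrow> Poly_Mapping.keys (f + g) \<subseteq> S"
  using keys_add[of f g] by blast

lemma keys_sum_subset:
  "(\<And>i. i \<in> I \<Longrightarrow> Poly_Mapping.keys (f i) \<subseteq> S) \<Longrightarrow> Poly_Mapping.keys (sum f I) \<subseteq> S"
  using keys_sum[of f I] by blast

abbreviation words_upto :: "nat \<Rightarrow> nat free_monoid set" where
  "words_upto n \<equiv> {w. length (letters w) \<le> n}"

context general_polynomials
begin

lemma gp_coord_component: "gp_coord i \<in> gp_component 1"
  using two_sided_gp_component by (auto simp: gp_coord_def gp_component.zero)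

lemma gp_of_nc_single_component:
  "gp_of_nc (Poly_Mapping.single w d) \<in> gp_component (length (letters w))"
proof -
  interpret g: Ring_Hom.ring_hom "gp_const :: 'a \<Rightarrow> _" by (rule ring_hom_gp_const)
  have "prod_list (map gp_coord xs) \<in> gp_component (length xs)" for xs
  proof (induction xs)
    case Nil
    show ?case using gp_monomial_component[of "1 :: 'a" "[]"] by simp
  next
    case (Cons x xs)
    then show ?case using gp_component_mult[OF gp_coord_component] by force
  qed
  then show ?thesis
    using gp_component_mult[OF gp_monomial_component[of d "[]"]] by (simp add: gp_of_nc)
qed

text \<open>The image of \<open>gp_z\<close> under \<open>h\<close> has only words of length at most
  one and a constant only the empty word, so \<open>h\<close> does not raise degrees.\<close>

lemma keys_gp_h_component:
  assumes "P \<in> gp_component n"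
  shows "Poly_Mapping.keys (gp_h N a P) \<subseteq> words_upto n"
  using assms
proof induction
  case zero
  interpret h: Ring_Hom.ring_hom "gp_h N a" by (rule gp_h)
  show ?case by simp
next
  case (add_monomial P bs b)
  interpret h: Ring_Hom.ring_hom "gp_h N a" by (rule gp_h)
  have const: "Poly_Mapping.keys (nc_const d) \<subseteq> words_upto 0" for d :: 'a
    by (simp add: nc_const_def zero_free_monoid_def)
  have var: "Poly_Mapping.keys (nc_var i :: 'a ncpoly) \<subseteq> words_upto 1" for i
    by (simp add: nc_var_def)
  have z: "Poly_Mapping.keys (gp_h N a gp_z) \<subseteq> words_upto 1"
    unfolding gp_h_z
    by (intro keys_sum_subset keys_mult_subset[OF const var]) (simp add: plus_free_monoid_def)
  have list: "Poly_Mapping.keys (gp_h N a (prod_list (map (\<lambda>b'. gp_z * gp_const b') bs)))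
      \<subseteq> words_upto (length bs)" for bs
  proof (induction bs)
    case Nil
    show ?case by (simp add: zero_free_monoid_def)
  next
    case (Cons b bs)
    have "Poly_Mapping.keys (gp_h N a (gp_z * gp_const b)) \<subseteq> words_upto 1"
      unfolding h.hom_mult gp_h(2)
      by (rule keys_mult_subset[OF z const]) (simp add: plus_free_monoid_def)
    from keys_mult_subset[OF this Cons.IH] show ?case
      by (simp add: h.hom_mult plus_free_monoid_def)
  qed
  have "Poly_Mapping.keys (gp_h N a (gp_monomial b bs)) \<subseteq> words_upto n"
    unfolding h.hom_mult[of "gp_const b"] gp_h(2)
    by (rule keys_mult_subset[OF const list]) (use add_monomial in \<open>simp add: plus_free_monoid_def\<close>)
  with add_monomial show ?case by (simp add: h.hom_add keys_add_subset)
qed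

text \<open>Sorting the terms of \<open>q\<close> by word length gives a decomposition up to
  \<open>n\<close>. Conversely, applying \<open>h\<close> to any decomposition up to
  \<open>m\<close> confines \<open>q\<close> to words of length at most \<open>m\<close>, and a word
  of length \<open>n\<close> occurs.\<close>

lemma gp_degree_gp_of_nc:
  assumes support: "\<And>w. w \<in> Poly_Mapping.keys q \<Longrightarrow> set (letters w) \<subseteq> {1..N}"
    and upper: "\<And>w. w \<in> Poly_Mapping.keys q \<Longrightarrow> length (letters w) \<le> n"
    and attained: "w \<in> Poly_Mapping.keys q" "length (letters w) = n"
  shows "gp_degree (gp_of_nc q) = n"
  unfolding gp_degree_def
proof (rule Least_equality)
  interpret g: Ring_Hom.ring_hom gp_of_nc by (rule gp_of_nc)
  let ?K = "Poly_Mapping.keys q"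
  let ?t = "\<lambda>w. gp_of_nc (Poly_Mapping.single w (Poly_Mapping.lookup q w))"
  define Q where "Q i = (\<Sum>w\<in>{w\<in>?K. length (letters w) = i}. ?t w)" for i
  have "Q i \<in> gp_component i" for i
    unfolding Q_def by (rule gp_component_sum) (use gp_of_nc_single_component in blast)
  moreover have "gp_of_nc q = (\<Sum>i\<le>n. Q i)"
  proof -
    have "gp_of_nc q = (\<Sum>w\<in>?K. ?t w)"
      by (simp add: poly_mapping_sum_single flip: g.hom_sum)
    also have "\<dots> = (\<Sum>i\<le>n. Q i)"
      unfolding Q_def by (rule sum.group[symmetric]) (use upper in auto)
    finally show ?thesis .
  qed
  ultimately show "\<exists>Q. (\<forall>i\<le>n. Q i \<in> gp_component i) \<and> gp_of_nc q = (\<Sum>i\<le>n. Q i)" by blast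
next
  interpret h: Ring_Hom.ring_hom "gp_h N a" by (rule gp_h)
  fix m assume "\<exists>Q. (\<forall>i\<le>m. Q i \<in> gp_component i) \<and> gp_of_nc q = (\<Sum>i\<le>m. Q i)"
  then obtain Q where Q: "\<And>i. i \<le> m \<Longrightarrow> Q i \<in> gp_component i" "gp_of_nc q = (\<Sum>i\<le>m. Q i)" by blast
  have "q = (\<Sum>i\<le>m. gp_h N a (Q i))"
    using gp_h_gp_of_nc[OF support] Q(2) by (metis h.hom_sum)
  moreover have "Poly_Mapping.keys (\<Sum>i\<le>m. gp_h N a (Q i)) \<subseteq> words_upto m"
    by (rule keys_sum_subset) (use keys_gp_h_component[OF Q(1)] in force)
  ultimately show "n \<le> m" using attained by auto
qed

end

section \<open>Matrices over a division ring\<close>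

text \<open>Gaussian elimination by induction on the equations. Coefficients stand to the left of
  the unknowns, so row operations use left multiples.\<close>

lemma underdetermined_homogeneous_system:
  fixes b :: "'i \<Rightarrow> 'j \<Rightarrow> 'd::division_ring"
  assumes "finite I" "finite J" "card I < card J"
  shows "\<exists>x. (\<exists>j\<in>J. x j \<noteq> 0) \<and> (\<forall>i\<in>I. (\<Sum>j\<in>J. b i j * x j) = 0)"
  using assms
proof (induction I arbitrary: J b rule: finite_induct)
  case empty
  then have "J \<noteq> {}" by auto
  then show ?case by (intro exI[of _ "\<lambda>_. 1"]) auto
next
  case (insert i0 I)
  show ?case
  proof (cases "\<forall>j\<in>J. b i0 j = 0")
    case True
    have "card I < card J" using insert by simp
    from insert.IH[OF insert.prems(1) this, of b] obtain x
      where "\<exists>j\<in>J. x j \<noteq> 0" "\<forall>i\<in>I. (\<Sum>j\<in>J. b i j * x j) = 0" by blast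
    with True show ?thesis by (intro exI[of _ x]) (auto intro: sum.neutral)
  next
    case False
    then obtain j0 where j0: "j0 \<in> J" "b i0 j0 \<noteq> 0" by blast
    define J' where "J' = J - {j0}"
    have J': "finite J'" "J = insert j0 J'" "j0 \<notin> J'"
      using j0 insert.prems by (auto simp: J'_def)
    have "card I < card J'" using insert J' by simp
    \<comment> \<open>Row \<open>i0\<close>, multiplied from the left, is subtracted from row
      \<open>i\<close> to clear column \<open>j0\<close>.\<close>
    from insert.IH[OF J'(1) this, of "\<lambda>i j. b i j - b i j0 * inverse (b i0 j0) * b i0 j"]
    obtain x where x: "\<exists>j\<in>J'. x j \<noteq> 0"
      "\<And>i. i \<in> I \<Longrightarrow> (\<Sum>j\<in>J'. (b i j - b i j0 * inverse (b i0 j0) * b i0 j) * x j) = 0" by blast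
    \<comment> \<open>The value at \<open>j0\<close> is the one that solves equation
      \<open>i0\<close>.\<close>
    define y where "y = x(j0 := - (inverse (b i0 j0) * (\<Sum>j\<in>J'. b i0 j * x j)))"
    have split: "(\<Sum>j\<in>J. b i j * y j) = (\<Sum>j\<in>J'. b i j * x j)
        - b i j0 * inverse (b i0 j0) * (\<Sum>j\<in>J'. b i0 j * x j)" for i
    proof -
      have "(\<Sum>j\<in>J'. b i j * y j) = (\<Sum>j\<in>J'. b i j * x j)"
        by (rule sum.cong) (use J' in \<open>auto simp: y_def\<close>)
      then show ?thesis using J' by (simp add: y_def mult.assoc)
    qed
    have "(\<Sum>j\<in>J. b i j * y j) = 0" if "i \<in> insert i0 I" for i
    proof (cases "i = i0")
      case True
      then show ?thesis using j0 by (simp add: split)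
    next
      case False
      then have "(\<Sum>j\<in>J'. b i j * x j - b i j0 * inverse (b i0 j0) * (b i0 j * x j)) = 0"
        using x(2)[of i] that by (simp add: left_diff_distrib mult.assoc)
      then show ?thesis by (simp add: split sum_subtractf sum_distrib_left)
    qed
    moreover have "\<exists>j\<in>J. y j \<noteq> 0" using x(1) J' by (auto simp: y_def)
    ultimately show ?thesis by blast
  qed
qed

text \<open>With a unit vector adjoined as an extra column, \<open>k\<close> equations in
  \<open>k + 1\<close> unknowns have a nonzero solution. The trivial kernel makes its last
  coordinate nonzero, and dividing by it gives a column of the inverse.\<close>

lemma mat_trivial_kernel_right_inverse:
  fixes B :: "'d::division_ring mat"
  assumes B: "B \<in> carrier_mat k k"
    and inj: "\<And>v. v \<in> carrier_vec k \<Longrightarrow> B *\<^sub>v v = 0\<^sub>v k \<Longrightarrow> v = 0\<^sub>v k"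
  shows "\<exists>C\<in>carrier_mat k k. B * C = 1\<^sub>m k"
proof -
  have "\<exists>c. \<forall>r<k. (\<Sum>j<k. B $$ (r, j) * c j) = (if r = i then 1 else 0)" for i
  proof -
    \<comment> \<open>Column \<open>k\<close> is the unit vector at \<open>i\<close>; it is zero for
      \<open>i \<ge> k\<close>, so no bound on \<open>i\<close> is imposed before the choice of
      \<open>c\<close>.\<close>
    define b where "b r j = (if j < k then B $$ (r, j) else if r = i then 1 else 0)" for r j
    have "card {..<k} < card {..k}" by simp
    from underdetermined_homogeneous_system[OF _ _ this, of b] obtain x where
      x: "\<exists>j\<in>{..k}. x j \<noteq> 0" "\<forall>r\<in>{..<k}. (\<Sum>j\<in>{..k}. b r j * x j) = 0" by auto
    have eq: "(\<Sum>j<k. B $$ (r, j) * x j) + (if r = i then x k else 0) = 0" if "r < k" for r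
    proof -
      have "(\<Sum>j\<le>k. b r j * x j) = (\<Sum>j<k. b r j * x j) + b r k * x k"
        by (simp add: lessThan_Suc_atMost[symmetric])
      also have "(\<Sum>j<k. b r j * x j) = (\<Sum>j<k. B $$ (r, j) * x j)"
        by (rule sum.cong) (auto simp: b_def)
      finally show ?thesis using x(2) that by (auto simp: b_def)
    qed
    have "x k \<noteq> 0"
    proof
      assume "x k = 0"
      then have "(\<Sum>j<k. B $$ (r, j) * x j) = 0" if "r < k" for r
        using eq[OF that] by (simp split: if_splits)
      then have "B *\<^sub>v vec k x = 0\<^sub>v k"
        using B by (intro eq_vecI) (auto simp: scalar_prod_def atLeast0LessThan)
      then have "vec k x = 0\<^sub>v k" by (rule inj[rotated]) simp
      then have "x j = 0" if "j < k" for j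
        using that by (metis index_vec index_zero_vec(1))
      with x(1) \<open>x k = 0\<close> show False by (metis atMost_iff le_neq_implies_less)
    qed
    have "(\<Sum>j<k. B $$ (r, j) * - (x j * inverse (x k))) = (if r = i then 1 else 0)" if "r < k" for r
    proof -
      have "(\<Sum>j<k. B $$ (r, j) * - (x j * inverse (x k)))
        = - (\<Sum>j<k. B $$ (r, j) * x j) * inverse (x k)"
        by (simp add: sum_distrib_right sum_negf mult.assoc)
      also have "- (\<Sum>j<k. B $$ (r, j) * x j) = (if r = i then x k else 0)"
        by (rule minus_unique) (rule eq[OF that])
      finally show ?thesis using \<open>x k \<noteq> 0\<close> by simp
    qed
    then show ?thesis by (intro exI[of _ "\<lambda>j. - (x j * inverse (x k))"] allI impI)
  qed
  then have "\<exists>c. \<forall>i. \<forall>r<k. (\<Sum>j<k. B $$ (r, j) * c i j) = (if r = i then 1 else 0)"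
    by (intro choice allI)
  then obtain c where c: "\<And>i r. r < k \<Longrightarrow> (\<Sum>j<k. B $$ (r, j) * c i j) = (if r = i then 1 else 0)"
    by blast
  have "B * mat k k (\<lambda>(j, i). c i j) = 1\<^sub>m k"
    using B c by (intro eq_matI) (auto simp: scalar_prod_def atLeast0LessThan)
  then show ?thesis by (intro bexI[of _ "mat k k (\<lambda>(j, i). c i j)"]) auto
qed

text \<open>A right inverse of \<open>B\<close> is carried by \<open>\<Phi>\<close> to one of
  \<open>\<Phi> B\<close>. Conversely, a kernel vector becomes a nonzero matrix \<open>C\<close>
  with \<open>B * C\<close> zero; by injectivity \<open>\<Phi> C\<close> is nonzero, so
  \<open>\<Phi> B\<close> is not invertible.\<close>

lemma det_matrix_embedding_eq_0_iff:
  fixes \<kappa> :: "'k::field \<Rightarrow> 'd::division_ring"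
  assumes emb: "matrix_embedding \<kappa> k n \<Phi>" and B: "B \<in> carrier_mat k k"
  shows "det (\<Phi> B) = 0 \<longleftrightarrow> (\<exists>v\<in>carrier_vec k. v \<noteq> 0\<^sub>v k \<and> B *\<^sub>v v = 0\<^sub>v k)"
proof -
  have car: "\<And>X. X \<in> carrier_mat k k \<Longrightarrow> \<Phi> X \<in> carrier_mat n n"
    and inj: "inj_on \<Phi> (carrier_mat k k)"
    and add: "\<And>X Y. X \<in> carrier_mat k k \<Longrightarrow> Y \<in> carrier_mat k k \<Longrightarrow> \<Phi> (X + Y) = \<Phi> X + \<Phi> Y"
    and mult: "\<And>X Y. X \<in> carrier_mat k k \<Longrightarrow> Y \<in> carrier_mat k k \<Longrightarrow> \<Phi> (X * Y) = \<Phi> X * \<Phi> Y"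
    and one: "\<Phi> (1\<^sub>m k) = 1\<^sub>m n"
    using emb unfolding matrix_embedding_def by blast+
  have zero: "\<Phi> (0\<^sub>m k k) = 0\<^sub>m n n"
  proof -
    have *: "\<Phi> (0\<^sub>m k k) = \<Phi> (0\<^sub>m k k) + \<Phi> (0\<^sub>m k k)"
      using add[of "0\<^sub>m k k" "0\<^sub>m k k"] by simp
    show ?thesis
    proof (rule eq_matI)
      fix i j assume "i < dim_row (0\<^sub>m n n :: 'k mat)" "j < dim_col (0\<^sub>m n n :: 'k mat)"
      moreover from this have "\<Phi> (0\<^sub>m k k) $$ (i, j) = \<Phi> (0\<^sub>m k k) $$ (i, j) + \<Phi> (0\<^sub>m k k) $$ (i, j)"
        using car[of "0\<^sub>m k k"] by (subst (1) *) simp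
      ultimately show "\<Phi> (0\<^sub>m k k) $$ (i, j) = 0\<^sub>m n n $$ (i, j)"
        by (simp only: add_cancel_right_right) simp
    qed (use car[of "0\<^sub>m k k"] in auto)
  qed
  show ?thesis
  proof
    assume det: "det (\<Phi> B) = 0"
    show "\<exists>v\<in>carrier_vec k. v \<noteq> 0\<^sub>v k \<and> B *\<^sub>v v = 0\<^sub>v k"
    proof (rule ccontr)
      assume "\<not> ?thesis"
      then obtain C where C: "C \<in> carrier_mat k k" "B * C = 1\<^sub>m k"
        using mat_trivial_kernel_right_inverse[OF B] by blast
      then have "\<Phi> B * \<Phi> C = 1\<^sub>m n" using mult[OF B] one by metis
      then have "det (\<Phi> B) * det (\<Phi> C) = 1"
        using det_mult[OF car[OF B] car[OF C(1)]] by simp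
      with det show False by simp
    qed
  next
    assume "\<exists>v\<in>carrier_vec k. v \<noteq> 0\<^sub>v k \<and> B *\<^sub>v v = 0\<^sub>v k"
    then obtain v where v: "v \<in> carrier_vec k" "v \<noteq> 0\<^sub>v k" "B *\<^sub>v v = 0\<^sub>v k" by blast
    \<comment> \<open>All columns equal \<open>v\<close>, since \<open>\<Phi>\<close> applies to
      square matrices rather than to vectors.\<close>
    define C where "C = mat k k (\<lambda>(i, j). v $ i)"
    have C: "C \<in> carrier_mat k k" by (simp add: C_def)
    have col: "col C j = v" if "j < k" for j using that v(1) by (intro eq_vecI) (auto simp: C_def)
    have "B * C = 0\<^sub>m k k"
    proof (rule eq_matI)
      fix i j assume ij: "i < dim_row (0\<^sub>m k k :: 'd mat)" "j < dim_col (0\<^sub>m k k :: 'd mat)"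
      then have "(B * C) $$ (i, j) = (B *\<^sub>v v) $ i" using B C by (simp add: col)
      then show "(B * C) $$ (i, j) = 0\<^sub>m k k $$ (i, j)" using ij v(3) by simp
    qed (use B C in auto)
    then have BC: "\<Phi> B * \<Phi> C = 0\<^sub>m n n" using mult[OF B C] zero by simp
    have "k > 0"
    proof (rule ccontr)
      assume "\<not> k > 0"
      then have "v = 0\<^sub>v k" using v(1) by (intro eq_vecI) auto
      with v(2) show False ..
    qed
    then have "C \<noteq> 0\<^sub>m k k"
      using v col[of 0] by (metis col_zero)
    then have "\<Phi> C \<noteq> 0\<^sub>m n n"
      using inj_onD[OF inj, of C "0\<^sub>m k k"] C zero by auto
    show "det (\<Phi> B) = 0"
    proof (rule ccontr)
      assume "det (\<Phi> B) \<noteq> 0"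
      from det_non_zero_imp_unit[OF car[OF B] this] obtain X where
        X: "X \<in> carrier_mat n n" "X * \<Phi> B = 1\<^sub>m n"
        unfolding Units_def ring_mat_def by auto
      have "\<Phi> C = X * \<Phi> B * \<Phi> C" using X car[OF C] by simp
      also have "\<dots> = X * (\<Phi> B * \<Phi> C)" by (rule assoc_mult_mat) (use X car B C in auto)
      also have "\<dots> = 0\<^sub>m n n" using X BC by simp
      finally show False using \<open>\<Phi> C \<noteq> 0\<^sub>m n n\<close> by simp
    qed
  qed
qed

lemma left_eigenvalue_iff_kernel:
  fixes A :: "'d::division_ring mat"
  assumes A: "A \<in> carrier_mat k k"
  shows "left_eigenvalue A l \<longleftrightarrow>
    (\<exists>v\<in>carrier_vec k. v \<noteq> 0\<^sub>v k \<and> (A - l \<cdot>\<^sub>m 1\<^sub>m k) *\<^sub>v v = 0\<^sub>v k)"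
proof -
  have "A *\<^sub>v v = l \<cdot>\<^sub>v v \<longleftrightarrow> (A - l \<cdot>\<^sub>m 1\<^sub>m k) *\<^sub>v v = 0\<^sub>v k" if v: "v \<in> carrier_vec k" for v
  proof -
    have "(l \<cdot>\<^sub>m 1\<^sub>m k) *\<^sub>v v = l \<cdot>\<^sub>v v"
    proof (rule eq_vecI)
      fix i assume i: "i < dim_vec (l \<cdot>\<^sub>v v)"
      then have "((l \<cdot>\<^sub>m 1\<^sub>m k) *\<^sub>v v) $ i = (\<Sum>j<k. l * (if j = i then 1 else 0) * v $ j)"
        using v by (auto simp: scalar_prod_def atLeast0LessThan)
      also have "\<dots> = (\<Sum>j<k. if j = i then l * v $ j else 0)"
        by (rule sum.cong) auto
      finally show "((l \<cdot>\<^sub>m 1\<^sub>m k) *\<^sub>v v) $ i = (l \<cdot>\<^sub>v v) $ i" using i v by simp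
    qed (use v in auto)
    then have *: "(A - l \<cdot>\<^sub>m 1\<^sub>m k) *\<^sub>v v = A *\<^sub>v v - l \<cdot>\<^sub>v v"
      using minus_mult_distrib_mat_vec[OF A _ v, of "l \<cdot>\<^sub>m 1\<^sub>m k"] by simp
    show ?thesis
    proof
      assume "(A - l \<cdot>\<^sub>m 1\<^sub>m k) *\<^sub>v v = 0\<^sub>v k"
      then have "(A *\<^sub>v v - l \<cdot>\<^sub>v v) $ i = 0" if "i < k" for i using that * by simp
      then show "A *\<^sub>v v = l \<cdot>\<^sub>v v" using A v by (intro eq_vecI) auto
    qed (use * v in simp)
  qed
  then show ?thesis using A unfolding left_eigenvalue_def by auto
qed

section \<open>Maximal subfields\<close>

definition centralizer :: "'d::division_ring set \<Rightarrow> 'd set" where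
  "centralizer S = {x. \<forall>y\<in>S. x * y = y * x}"

text \<open>The double centralizer of \<open>S\<close> contains \<open>S\<close> and the center. As
  \<open>S\<close> is commutative, it lies in its centralizer, so the double centralizer lies there
  too and is commutative. By maximality it equals \<open>S\<close>.\<close>

lemma center_subset_maximal_subfield:
  assumes "maximal_subfield S"
  shows "of_center c \<in> S"
proof -
  let ?T = "centralizer (centralizer S)"
  have S: "subfield_of S" using assms by (simp add: maximal_subfield_def)
  then have comm: "S \<subseteq> centralizer S" by (auto simp: subfield_of_def centralizer_def)
  have anti: "centralizer U \<subseteq> centralizer V" if "V \<subseteq> U" for U V :: "'a set"
    using that by (auto simp: centralizer_def)
  have "subfield_of ?T" unfolding subfield_of_def
  proof (intro conjI ballI)
    fix x y assume xy: "x \<in> ?T" "y \<in> ?T"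
    show "x - y \<in> ?T" using xy by (auto simp: centralizer_def algebra_simps)
    have "x * y * z = z * (x * y)" if "z \<in> centralizer S" for z
    proof -
      have "x * z = z * x" "y * z = z * y" using xy that unfolding centralizer_def by blast+
      then show ?thesis by (metis mult.assoc)
    qed
    then show "x * y \<in> ?T" unfolding centralizer_def[of "centralizer S"] by blast
    show "x * y = y * x"
      using xy anti[OF comm] unfolding centralizer_def[of "centralizer S"] by blast
  next
    fix x assume x: "x \<in> ?T"
    have "inverse x * z = z * inverse x" if "z \<in> centralizer S" for z
    proof (cases "x = 0")
      case False
      have "x * z = z * x" using x that unfolding centralizer_def by blast
      have "inverse x * z = inverse x * (z * x) * inverse x"
        using False by (simp add: mult.assoc)
      also have "\<dots> = inverse x * (x * z) * inverse x" by (simp add: \<open>x * z = z * x\<close>)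
      also have "\<dots> = z * inverse x" using False by (simp flip: mult.assoc)
      finally show ?thesis .
    qed simp
    then show "inverse x \<in> ?T" unfolding centralizer_def[of "centralizer S"] by blast
  qed (simp add: centralizer_def)
  moreover have "S \<subseteq> ?T" by (auto simp: centralizer_def)
  ultimately have "?T = S" using assms by (simp add: maximal_subfield_def)
  moreover have "of_center c \<in> ?T" by (simp add: centralizer_def of_center_commute)
  ultimately show ?thesis by simp
qed

section \<open>The determinant of the generic matrix\<close>

abbreviation monomials_upto :: "nat \<Rightarrow> nat \<Rightarrow> nat multiset set" where
  "monomials_upto N n \<equiv> {m. size m \<le> n \<and> set_mset m \<subseteq> {1..N}}"

text \<open>\<open>S\<close> is a filtration of the monomials, with \<open>S r\<close> containing
  the support of any product of \<open>r\<close> entries; the Leibniz formula does the rest.\<close>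

lemma keys_det_subset:
  fixes M :: "('m::comm_monoid_add \<Rightarrow>\<^sub>0 'c::comm_ring_1) mat"
  assumes M: "M \<in> carrier_mat n n"
    and entry: "\<And>i j. i < n \<Longrightarrow> j < n \<Longrightarrow> Poly_Mapping.keys (M $$ (i, j)) \<subseteq> S 1"
    and zero: "0 \<in> S 0" and add: "\<And>i j u v. u \<in> S i \<Longrightarrow> v \<in> S j \<Longrightarrow> u + v \<in> S (i + j)"
  shows "Poly_Mapping.keys (det M) \<subseteq> S n"
  unfolding det_def'[OF M]
proof (rule keys_sum_subset)
  fix p assume "p \<in> {p. p permutes {0..<n}}"
  then have p: "p i < n" if "i < n" for i
    using that permutes_in_image[of p "{0..<n}" i] by simp
  have "Poly_Mapping.keys (\<Prod>i=0..<r. M $$ (i, p i)) \<subseteq> S r" if "r \<le> n" for r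
    using that
  proof (induction r)
    case (Suc r)
    then have "Poly_Mapping.keys ((\<Prod>i=0..<r. M $$ (i, p i)) * M $$ (r, p r)) \<subseteq> S (r + 1)"
      by (intro keys_mult_subset[OF _ entry add]) (auto intro: p)
    then show ?case by simp
  qed (simp add: zero)
  then show "Poly_Mapping.keys (signof p * (\<Prod>i=0..<n. M $$ (i, p i))) \<subseteq> S n"
    by (cases "evenperm p") (simp_all add: sign_def)
qed

lemma keys_det_generic_mat:
  fixes \<Phi> :: "'d::division_ring mat \<Rightarrow> 'k::field mat"
  assumes "N > 0"
  shows "Poly_Mapping.keys (det (generic_mat N a k n \<Phi> A)) \<subseteq> monomials_upto N n"
proof (rule keys_det_subset[where S = "monomials_upto N"])
  have const: "Poly_Mapping.keys (mv_const c) \<subseteq> monomials_upto N 0" for c :: 'k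
    by (simp add: mv_const_def)
  have var: "Poly_Mapping.keys (mv_var i * mv_const c) \<subseteq> monomials_upto N 1"
    if "1 \<le> i" "i \<le> N" for c :: 'k and i
  proof (rule keys_mult_subset[OF _ const])
    show "Poly_Mapping.keys (mv_var i :: 'k mvpoly) \<subseteq> monomials_upto N 1"
      using that by (simp add: mv_var_def)
  qed auto
  have const1: "Poly_Mapping.keys (mv_const c) \<subseteq> monomials_upto N 1" for c :: 'k
    using const[of c] by auto
  have diff: "Poly_Mapping.keys (f - g) \<subseteq> S"
    if "Poly_Mapping.keys f \<subseteq> S" "Poly_Mapping.keys g \<subseteq> S" for f g :: "'k mvpoly" and S
    using that by (auto simp: in_keys_iff lookup_minus subset_iff) (metis diff_0_right)
  show "Poly_Mapping.keys (generic_mat N a k n \<Phi> A $$ (i, j)) \<subseteq> monomials_upto N 1"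
    if "i < n" "j < n" for i j
    unfolding generic_mat_def index_mat(1)[OF that]
    by (intro diff keys_add_subset keys_sum_subset var const1) (use assms in auto)
qed (auto simp: generic_mat_def)

section \<open>Evaluating the generic determinant\<close>

definition mv_eval :: "('k::field \<Rightarrow> 'r::comm_ring_1) \<Rightarrow> (nat \<Rightarrow> 'r) \<Rightarrow> 'k mvpoly \<Rightarrow> 'r" where
  "mv_eval \<phi> y = mon_eval \<phi> (\<lambda>m. prod_mset (image_mset y m))"

lemma mv_eval:
  fixes \<phi> :: "'k::field \<Rightarrow> 'r::comm_ring_1"
  assumes "Ring_Hom.ring_hom \<phi>"
  shows "comm_ring_hom (mv_eval \<phi> y)"
    and "mv_eval \<phi> y (mv_const c) = \<phi> c"
    and "mv_eval \<phi> y (mv_var i) = y i"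
proof -
  interpret Ring_Hom.ring_hom \<phi> by fact
  note hom = ring_hom_mon_eval[OF assms, of "\<lambda>m. prod_mset (image_mset y m)"]
  interpret E: Ring_Hom.ring_hom "mv_eval \<phi> y"
    unfolding mv_eval_def by (rule hom) (simp_all add: mult.commute)
  show "comm_ring_hom (mv_eval \<phi> y)" by unfold_locales
  have single: "mv_eval \<phi> y (Poly_Mapping.single m c) = \<phi> c * prod_mset (image_mset y m)" for m c
    unfolding mv_eval_def by (rule hom) (simp_all add: mult.commute)
  show "mv_eval \<phi> y (mv_const c) = \<phi> c" "mv_eval \<phi> y (mv_var i) = y i"
    by (simp_all add: mv_const_def mv_var_def single)
qed

text \<open>Evaluation is a ring homomorphism and commutes with \<open>det\<close>. The map
  \<open>\<phi>\<close> stays general because both scalar values and values in a univariate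
  polynomial ring are substituted.\<close>

lemma mv_eval_det_generic_mat:
  assumes "Ring_Hom.ring_hom \<phi>"
  shows "mv_eval \<phi> y (det (generic_mat N a k n \<Phi> A)) = det (mat n n (\<lambda>rs. \<phi> (\<Phi> A $$ rs)
     - (y 1 * \<phi> (\<Phi> (1\<^sub>m k) $$ rs) + (\<Sum>i = 1..<N. y (i + 1) * \<phi> (\<Phi> (a i \<cdot>\<^sub>m 1\<^sub>m k) $$ rs)))))"
proof -
  interpret E: comm_ring_hom "mv_eval \<phi> y" by (rule mv_eval[OF assms])
  have "map_mat (mv_eval \<phi> y) (generic_mat N a k n \<Phi> A) = mat n n (\<lambda>rs. \<phi> (\<Phi> A $$ rs)
     - (y 1 * \<phi> (\<Phi> (1\<^sub>m k) $$ rs) + (\<Sum>i = 1..<N. y (i + 1) * \<phi> (\<Phi> (a i \<cdot>\<^sub>m 1\<^sub>m k) $$ rs))))"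
    by (rule eq_matI) (simp_all add: generic_mat_def E.hom_minus E.hom_add E.hom_mult E.hom_sum
        mv_eval[OF assms])
  then show ?thesis by (simp flip: E.hom_det)
qed

text \<open>Setting \<open>x\<^sub>1 = X\<close> and the other variables to \<open>0\<close> turns the generic determinant into the
  characteristic polynomial of \<open>\<Phi> A\<close> up to sign, which bounds the degree from below.\<close>

lemma keys_det_generic_mat_attained:
  fixes \<Phi> :: "'d::division_ring mat \<Rightarrow> 'k::field mat"
  assumes \<Phi>A: "\<Phi> A \<in> carrier_mat n n" and one: "\<Phi> (1\<^sub>m k) = 1\<^sub>m n"
  shows "\<exists>m\<in>Poly_Mapping.keys (det (generic_mat N a k n \<Phi> A)). size m \<ge> n"
proof (rule ccontr)
  assume "\<not> ?thesis"
  then have small: "size m < n" if "m \<in> Poly_Mapping.keys (det (generic_mat N a k n \<Phi> A))" for m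
    using that by force
  define y :: "nat \<Rightarrow> 'k poly" where "y i = (if i = 1 then [:0, 1:] else 0)" for i
  have hom: "Ring_Hom.ring_hom (\<lambda>c :: 'k. [:c:])" by unfold_locales simp_all
  \<comment> \<open>A monomial takes a value of degree at most its size, so monomials of size below
    \<open>n\<close> contribute nothing to the coefficient at \<open>n\<close>.\<close>
  have "degree (prod_mset (image_mset y m)) \<le> size m" for m
  proof (induction m)
    case (add x m)
    have "degree (y x * prod_mset (image_mset y m)) \<le> degree (y x) + degree (prod_mset (image_mset y m))"
      by (rule degree_mult_le)
    also have "\<dots> \<le> 1 + size m" using add by (intro add_mono) (simp add: y_def)
    finally show ?case by simp
  qed simp
  then have "coeff (prod_mset (image_mset y m)) n = 0"
    if "m \<in> Poly_Mapping.keys (det (generic_mat N a k n \<Phi> A))" for m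
    using small[OF that] by (intro coeff_eq_0) (meson le_less_trans)
  then have "coeff (mv_eval (\<lambda>c. [:c:]) y (det (generic_mat N a k n \<Phi> A))) n = 0"
    by (simp add: mv_eval_def mon_eval_def coeff_sum)
  moreover have "mv_eval (\<lambda>c. [:c:]) y (det (generic_mat N a k n \<Phi> A))
      = det ((- 1) \<cdot>\<^sub>m char_poly_matrix (\<Phi> A))"
    unfolding mv_eval_det_generic_mat[OF hom]
    by (rule arg_cong[of _ _ det], rule eq_matI)
      (use \<Phi>A in \<open>auto simp: char_poly_matrix_def y_def one one_pCons\<close>)
  moreover have "coeff (det ((- 1) \<cdot>\<^sub>m char_poly_matrix (\<Phi> A))) n = (- 1) ^ n"
  proof -
    have "det ((- 1) \<cdot>\<^sub>m char_poly_matrix (\<Phi> A)) = (- 1) ^ n * char_poly (\<Phi> A)"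
      using \<Phi>A by (simp add: char_poly_def char_poly_matrix_def)
    also have "(- 1) ^ n = [:(- 1 :: 'k) ^ n:]"
      by (induction n) (simp_all add: one_pCons)
    finally show ?thesis using degree_monic_char_poly[OF \<Phi>A] by simp
  qed
  ultimately show False by simp
qed

section \<open>Passing from commutative to noncommutative polynomials\<close>

lemma ring_hom_field_eq_0_iff:
  fixes \<kappa> :: "'k::field \<Rightarrow> 'r::ring_1"
  assumes "Ring_Hom.ring_hom \<kappa>"
  shows "\<kappa> c = 0 \<longleftrightarrow> c = 0"
proof -
  interpret Ring_Hom.ring_hom \<kappa> by fact
  show ?thesis by (metis hom_mult hom_one hom_zero mult_zero_left right_inverse zero_neq_one)
qed

text \<open>A word determines its multiset of letters, so \<open>\<omega>\<close> is injective and
  terms cannot merge; \<open>\<kappa>\<close> is injective, so none vanishes.\<close>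

lemma keys_nc_of_mv:
  fixes \<kappa> :: "'k::field \<Rightarrow> 'd::division_ring"
  assumes "Ring_Hom.ring_hom \<kappa>" and \<omega>: "monomial_words \<omega>"
  shows "Poly_Mapping.keys (nc_of_mv \<kappa> \<omega> f) = \<omega> ` Poly_Mapping.keys f"
proof -
  have inj: "\<omega> m = \<omega> m' \<longleftrightarrow> m = m'" for m m'
    using \<omega> unfolding monomial_words_def by metis
  have lookup: "Poly_Mapping.lookup (nc_of_mv \<kappa> \<omega> f) w
      = (\<Sum>m\<in>Poly_Mapping.keys f. if \<omega> m = w then \<kappa> (Poly_Mapping.lookup f m) else 0)" for w
    by (simp add: nc_of_mv_def lookup_sum lookup_single when_def)
  have "Poly_Mapping.lookup (nc_of_mv \<kappa> \<omega> f) (\<omega> m) = \<kappa> (Poly_Mapping.lookup f m)"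
    if "m \<in> Poly_Mapping.keys f" for m
    using that by (simp add: lookup inj)
  then have "\<omega> ` Poly_Mapping.keys f \<subseteq> Poly_Mapping.keys (nc_of_mv \<kappa> \<omega> f)"
    using ring_hom_field_eq_0_iff[OF assms(1)] by (auto simp: in_keys_iff)
  moreover have "Poly_Mapping.keys (nc_of_mv \<kappa> \<omega> f) \<subseteq> \<omega> ` Poly_Mapping.keys f"
  proof
    fix w assume "w \<in> Poly_Mapping.keys (nc_of_mv \<kappa> \<omega> f)"
    then have "Poly_Mapping.lookup (nc_of_mv \<kappa> \<omega> f) w \<noteq> 0" by (simp add: in_keys_iff)
    then obtain m where "m \<in> Poly_Mapping.keys f"
      "(if \<omega> m = w then \<kappa> (Poly_Mapping.lookup f m) else 0) \<noteq> 0"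
      unfolding lookup by (rule sum.not_neutral_contains_not_neutral)
    then show "w \<in> \<omega> ` Poly_Mapping.keys f" by (auto split: if_splits)
  qed
  ultimately show ?thesis by blast
qed

text \<open>At central values the order of factors chosen by \<open>\<omega>\<close> is immaterial,
  and all computation takes place inside the image of \<open>\<kappa>\<close>.\<close>

lemma nc_eval_nc_of_mv:
  fixes \<kappa> :: "'k::field \<Rightarrow> 'd::division_ring"
  assumes "Ring_Hom.ring_hom \<kappa>" and \<omega>: "monomial_words \<omega>"
    and y: "\<And>i. y i = \<kappa> (s i)" and central: "\<And>d i. d * y i = y i * d"
  shows "nc_eval (\<lambda>d. d) y (nc_of_mv \<kappa> \<omega> f) = \<kappa> (mv_eval (\<lambda>c. c) s f)"
proof -
  interpret Ring_Hom.ring_hom \<kappa> by fact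
  note E = nc_eval[OF ring_hom_ident, of y, OF central]
  interpret E: Ring_Hom.ring_hom "nc_eval (\<lambda>d. d) y" by (rule E)
  have "prod_list (map y (letters (\<omega> m))) = \<kappa> (prod_mset (image_mset s m))" for m
  proof -
    have "prod_list (map y xs) = \<kappa> (prod_mset (image_mset s (mset xs)))" for xs
      by (induction xs) (simp_all add: y hom_mult)
    then show ?thesis using \<omega> unfolding monomial_words_def by metis
  qed
  then show ?thesis
    by (simp add: nc_of_mv_def E.hom_sum E mv_eval_def mon_eval_def hom_sum hom_mult)
qed

text \<open>Linearity of \<open>\<Phi>\<close> over the center expresses the image of a scalar
  matrix through the images of the basis. The entrywise form matches that of
  \<open>generic_mat\<close>.\<close>

lemma matrix_embedding_scalar_sum:
  fixes \<kappa> :: "'k::field \<Rightarrow> 'd::division_ring"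
  assumes emb: "matrix_embedding \<kappa> k n \<Phi>" and A: "A \<in> carrier_mat k k"
    and s: "\<And>i. i \<in> I \<Longrightarrow> \<kappa> (s i) = of_center (c i)" and rs: "r < n" "t < n"
  shows "\<Phi> (A - (\<Sum>i\<in>I. of_center (c i) * e i) \<cdot>\<^sub>m 1\<^sub>m k) $$ (r, t)
    = \<Phi> A $$ (r, t) - (\<Sum>i\<in>I. s i * \<Phi> (e i \<cdot>\<^sub>m 1\<^sub>m k) $$ (r, t))"
proof -
  have car: "\<And>X. X \<in> carrier_mat k k \<Longrightarrow> \<Phi> X \<in> carrier_mat n n"
    and add: "\<And>X Y. X \<in> carrier_mat k k \<Longrightarrow> Y \<in> carrier_mat k k \<Longrightarrow> \<Phi> (X + Y) = \<Phi> X + \<Phi> Y"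
    and scale: "\<And>s c X. \<kappa> s = of_center c \<Longrightarrow> X \<in> carrier_mat k k \<Longrightarrow> \<Phi> (\<kappa> s \<cdot>\<^sub>m X) = s \<cdot>\<^sub>m \<Phi> X"
    using emb unfolding matrix_embedding_def by blast+
  have add_entry: "\<Phi> (X + Y) $$ (r, t) = \<Phi> X $$ (r, t) + \<Phi> Y $$ (r, t)"
    if "X \<in> carrier_mat k k" "Y \<in> carrier_mat k k" for X Y
    using add[OF that] car[OF that(1)] car[OF that(2)] rs by simp
  define \<psi> where "\<psi> d = \<Phi> (d \<cdot>\<^sub>m 1\<^sub>m k) $$ (r, t)" for d
  have \<psi>_add: "\<psi> (x + y) = \<psi> x + \<psi> y" for x y
  proof -
    have "(x + y) \<cdot>\<^sub>m 1\<^sub>m k = x \<cdot>\<^sub>m 1\<^sub>m k + y \<cdot>\<^sub>m 1\<^sub>m k"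
      by (rule eq_matI) (auto simp: distrib_right)
    then show ?thesis unfolding \<psi>_def by (simp add: add_entry)
  qed
  have "\<psi> 0 + \<psi> 0 = \<psi> 0" by (simp flip: \<psi>_add)
  then have \<psi>_0: "\<psi> 0 = 0" by (metis add_cancel_right_right)
  have \<psi>_scale: "\<psi> (of_center (c i) * x) = s i * \<psi> x" if "i \<in> I" for i x
  proof -
    have "(of_center (c i) * x) \<cdot>\<^sub>m 1\<^sub>m k = \<kappa> (s i) \<cdot>\<^sub>m (x \<cdot>\<^sub>m 1\<^sub>m k)"
      by (rule eq_matI) (auto simp: s[OF that])
    then show ?thesis
      unfolding \<psi>_def using scale[OF s[OF that], of "x \<cdot>\<^sub>m 1\<^sub>m k"] car[of "x \<cdot>\<^sub>m 1\<^sub>m k"] rs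
      by simp
  qed
  have \<psi>_sum: "\<psi> (\<Sum>i\<in>J. of_center (c i) * e i) = (\<Sum>i\<in>J. s i * \<psi> (e i))" if "J \<subseteq> I" for J
    using that by (induction J rule: infinite_finite_induct) (simp_all add: \<psi>_0 \<psi>_add \<psi>_scale)
  let ?l = "\<Sum>i\<in>I. of_center (c i) * e i"
  \<comment> \<open>Additivity of \<open>\<Phi>\<close> is given for sums, so the difference is
    reached by writing \<open>A\<close> as a sum.\<close>
  have "A = (A - ?l \<cdot>\<^sub>m 1\<^sub>m k) + ?l \<cdot>\<^sub>m 1\<^sub>m k" using A by (intro eq_matI) auto
  then have "\<Phi> A $$ (r, t) = \<Phi> (A - ?l \<cdot>\<^sub>m 1\<^sub>m k) $$ (r, t) + \<psi> ?l"
    unfolding \<psi>_def using A by (metis add_entry minus_carrier_mat one_carrier_mat smult_carrier_mat)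
  then show ?thesis using \<psi>_sum[of I] by (simp add: \<psi>_def)
qed

section \<open>Eigenvalues as roots, and the degree of the characteristic polynomial\<close>

theorem mainTheorem2:
  fixes p N k :: nat
    and a :: "nat \<Rightarrow> 'd::division_ring"
    and \<kappa> :: "'k::field \<Rightarrow> 'd"
    and \<Phi> :: "'d mat \<Rightarrow> 'k mat"
    and \<omega> :: "nat multiset \<Rightarrow> nat free_monoid"
    and A :: "'d mat"
  assumes "N = p ^ 2"
    and "vector_space.dim center_scale (UNIV :: 'd set) = N"
    and "\<forall>i\<in>{1..<N}. \<exists>b. a i * b = 1 \<and> b * a i = 1"
    and "\<forall>d :: 'd. \<exists>c :: nat \<Rightarrow> 'd center.
           d = of_center (c 0) + (\<Sum>i = 1..<N. of_center (c i) * a i)"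
    and "Ring_Hom.ring_hom \<kappa>" and "maximal_subfield (range \<kappa>)"
    and "matrix_embedding \<kappa> k (k * p) \<Phi>"
    and "monomial_words \<omega>"
    and "A \<in> carrier_mat k k"
  shows "{l. left_eigenvalue A l} = {l. gp_subst l (gp_char_poly \<kappa> \<omega> N a k (k * p) \<Phi> A) = 0}
    \<and> gp_degree (gp_char_poly \<kappa> \<omega> N a k (k * p) \<Phi> A) = k * p"
proof -
  define e where "e = a(0 := 1)"
  define f where "f = det (generic_mat N a k (k * p) \<Phi> A)"
  define q where "q = nc_of_mv \<kappa> \<omega> f"
  \<comment> \<open>Stated for general \<open>g\<close>, since slot 0 is split off both for elements
    of the division ring and for entries of their images.\<close>
  have sum_e: "(\<Sum>i<N. g i (e i)) = g 0 1 + (\<Sum>i=1..<N. g i (a i))" if "N > 0"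
    for g :: "nat \<Rightarrow> 'd \<Rightarrow> 'x::comm_monoid_add"
  proof -
    have "{..<N} = insert 0 {1..<N}" using that by auto
    then show ?thesis by (simp add: e_def)
  qed
  \<comment> \<open>For \<open>N = 0\<close> the spanning assumption would make the division ring
    equal to its center, hence of dimension 1 rather than 0.\<close>
  have "N > 0"
  proof (rule ccontr)
    interpret V: vector_space "center_scale :: 'd center \<Rightarrow> _" by (rule vector_space_center_scale)
    assume "\<not> N > 0"
    then have "\<exists>c. d = of_center c" for d :: 'd using assms(4) by auto
    then have "\<exists>c. d = center_scale c 1" for d :: 'd by (simp add: center_scale_def)
    then have "UNIV \<subseteq> V.span {1}"
      by (metis V.span_base V.span_scale insertI1 subsetI)
    moreover have "V.independent {1}" by simp
    ultimately have "V.dim UNIV = 1" using V.dim_eq_card[of "{1}" UNIV] by (simp add: top.extremum_unique)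
    with assms(2) \<open>\<not> N > 0\<close> show False by simp
  qed
  have spanning: "\<exists>c. d = (\<Sum>i<N. of_center (c i) * e i)" for d
  proof -
    obtain c where "d = of_center (c 0) + (\<Sum>i = 1..<N. of_center (c i) * a i)"
      using assms(4) by blast
    then show ?thesis
      using sum_e[OF \<open>N > 0\<close>, of "\<lambda>i x. of_center (c i) * x"] by (intro exI[of _ c]) simp
  qed
  interpret general_polynomials N e a
    by unfold_locales
      (fact center_independentI[OF assms(2) spanning] spanning \<open>N > 0\<close> e_def)+
  have car: "\<Phi> X \<in> carrier_mat (k * p) (k * p)" if "X \<in> carrier_mat k k" for X
    using assms(7) that unfolding matrix_embedding_def by auto
  have one: "\<Phi> (1\<^sub>m k) = 1\<^sub>m (k * p)"
    using assms(7) unfolding matrix_embedding_def by blast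
  note keys_q = keys_nc_of_mv[OF assms(5,8), of f, folded q_def]
  have keys_f: "Poly_Mapping.keys f \<subseteq> monomials_upto N (k * p)"
    unfolding f_def by (rule keys_det_generic_mat) (rule \<open>N > 0\<close>)
  have \<omega>: "mset (letters (\<omega> m)) = m" for m using assms(8) by (simp add: monomial_words_def)
  have size_\<omega>: "length (letters (\<omega> m)) = size m" for m
    by (metis \<omega> size_mset)
  have set_\<omega>: "set (letters (\<omega> m)) = set_mset m" for m
    by (metis \<omega> set_mset_mset)
  have support: "set (letters w) \<subseteq> {1..N}" if "w \<in> Poly_Mapping.keys q" for w
  proof -
    from that keys_q obtain m where m: "m \<in> Poly_Mapping.keys f" "w = \<omega> m" by auto
    with keys_f have "set_mset m \<subseteq> {1..N}" by blast
    with m show ?thesis by (simp only: set_\<omega>)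
  qed
  have upper: "length (letters w) \<le> k * p" if "w \<in> Poly_Mapping.keys q" for w
    using that keys_q keys_f size_\<omega> by auto
  have char: "gp_char_poly \<kappa> \<omega> N a k (k * p) \<Phi> A = gp_of_nc q"
    unfolding gp_char_poly_def f_def[symmetric] q_def[symmetric]
    by (rule inv_gp_h) (rule support)
  \<comment> \<open>Together with the upper bound \<open>keys_f\<close> this gives a monomial of
    size exactly \<open>k * p\<close>, whose word occurs in \<open>q\<close>.\<close>
  obtain m where "m \<in> Poly_Mapping.keys f" "size m \<ge> k * p"
    using keys_det_generic_mat_attained[OF car[OF assms(9)] one] unfolding f_def by blast
  then have "\<omega> m \<in> Poly_Mapping.keys q" "length (letters (\<omega> m)) = k * p"
    using keys_q keys_f size_\<omega> by auto
  with support upper have degree: "gp_degree (gp_of_nc q) = k * p" by (rule gp_degree_gp_of_nc)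
  have "left_eigenvalue A l \<longleftrightarrow> gp_subst l (gp_of_nc q) = 0" for l
  proof -
    obtain c where c: "l = (\<Sum>i<N. of_center (c i) * e i)" using spanning by blast
    \<comment> \<open>The coordinates of \<open>l\<close> are central and so lie in the maximal
      subfield, which turns them into scalars of the field \<open>'k\<close>.\<close>
    have "\<exists>s. of_center (c i) = \<kappa> s" for i
      using center_subset_maximal_subfield[OF assms(6), of "c i"] by blast
    then obtain s where s: "\<And>i. of_center (c i) = \<kappa> (s i)" by metis
    have X: "A - l \<cdot>\<^sub>m 1\<^sub>m k \<in> carrier_mat k k" using assms(9) by auto
    note B = car[OF X]
    \<comment> \<open>Substitution of \<open>l\<close> becomes evaluation at its coordinates, then
      evaluation of the commutative polynomial \<open>f\<close>, and finally the determinant of the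
      image of \<open>A - l I\<close>.\<close>
    have "gp_subst l (gp_of_nc q) = nc_eval (\<lambda>d. d) (\<lambda>i. of_center (c (i - 1))) q"
      by (rule gp_subst_gp_of_nc[OF c support])
    also have "\<dots> = \<kappa> (mv_eval (\<lambda>c. c) (\<lambda>i. s (i - 1)) f)"
      unfolding q_def
      by (rule nc_eval_nc_of_mv[OF assms(5,8)]) (rule s, rule of_center_commute[symmetric])
    also have "mv_eval (\<lambda>c. c) (\<lambda>i. s (i - 1)) f = det (\<Phi> (A - l \<cdot>\<^sub>m 1\<^sub>m k))"
      unfolding f_def mv_eval_det_generic_mat[OF ring_hom_ident]
    proof (rule arg_cong[of _ _ det], rule eq_matI)
      fix r t assume "r < dim_row (\<Phi> (A - l \<cdot>\<^sub>m 1\<^sub>m k))" "t < dim_col (\<Phi> (A - l \<cdot>\<^sub>m 1\<^sub>m k))"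
      then have rt: "r < k * p" "t < k * p" using B by auto
      have "\<Phi> (A - l \<cdot>\<^sub>m 1\<^sub>m k) $$ (r, t)
        = \<Phi> A $$ (r, t) - (\<Sum>i<N. s i * \<Phi> (e i \<cdot>\<^sub>m 1\<^sub>m k) $$ (r, t))"
        unfolding c by (rule matrix_embedding_scalar_sum[OF assms(7,9) _ rt]) (simp add: s)
      moreover have "1 \<cdot>\<^sub>m 1\<^sub>m k = (1\<^sub>m k :: 'd mat)" by (rule eq_matI) auto
      ultimately show "mat (k * p) (k * p) (\<lambda>rs. \<Phi> A $$ rs
          - (s (1 - 1) * \<Phi> (1\<^sub>m k) $$ rs
            + (\<Sum>i = 1..<N. s (i + 1 - 1) * \<Phi> (a i \<cdot>\<^sub>m 1\<^sub>m k) $$ rs))) $$ (r, t)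
        = \<Phi> (A - l \<cdot>\<^sub>m 1\<^sub>m k) $$ (r, t)"
        using rt sum_e[OF \<open>N > 0\<close>, of "\<lambda>i x. s i * \<Phi> (x \<cdot>\<^sub>m 1\<^sub>m k) $$ (r, t)"] by simp
    qed (use B in auto)
    finally have "gp_subst l (gp_of_nc q) = \<kappa> (det (\<Phi> (A - l \<cdot>\<^sub>m 1\<^sub>m k)))" .
    then show ?thesis
      using ring_hom_field_eq_0_iff[OF assms(5)] left_eigenvalue_iff_kernel[OF assms(9), of l]
        det_matrix_embedding_eq_0_iff[OF assms(7) X] by simp
  qed
  then show ?thesis by (simp add: char degree)
qed

end
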